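(* Let $T: L^2(G) \to L^2(G)$ be the linear map defined on the basis $\mathcal{B}=\{e_{ij}^k : 1\le i,j\le n_k,\ 1\le k\le r\}$ by $T(e_{ij}^k) = e_{ji}^k$ for all $e_{ij}^k\in\mathcal{B}$, and let $\widetilde{\sigma}: G \to \mathrm{Aut}(L^2(G))$ be defined by $\widetilde{\sigma}_g = T\circ \rho_g\circ T$ for all $g\in G$. Then $T$ is an involutive linear automorphism of $L^2(G)$, $\widetilde{\sigma}$ is a representation of $G$, and: (i) $\rho_g\circ T = T\circ \widetilde{\sigma}_g$ for all $g\in G$; (ii) $\rho_g\circ\widetilde{\sigma}_h = \widetilde{\sigma}_h\circ\rho_g$ for all $g,h\in G$; (iii) $\mathrm{Tr}(\rho_g\circ T) = \chi_G(g)$ for all $g\in G$.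
   Context: $G$ is a finite group and $L^2(G)$ is the complex vector space of all functions $G\to\mathbb{C}$ (with its usual $L^2$ inner product). $\rho$ is the right regular representation of $G$ on $L^2(G)$: $(\rho_g f)(h) = f(hg)$. $(U_k,\pi_k)$, $1\le k\le r$, are the irreducible unitary complex representations of $G$ up to isomorphism, each listed once, $n_k=\dim U_k$, and $\chi_k$ is the character of $\pi_k$. For each $k$ an orthonormal basis of $U_k$ is fixed, and $(e_{ij}^k(g))_{1\le i,j\le n_k}$ denotes the matrix of $\pi_k(g)$ with respect to this basis, so that $e_{ij}^k(gh)=\sum_{l=1}^{n_k}e_{il}^k(g)e_{lj}^k(h)$ and $e_{ij}^k(g^{-1})=\overline{e_{ji}^k(g)}$. The functions $e_{ij}^k$ ($1\le i,j\le n_k$, $1\le k\le r$) form a basis $\mathcal{B}$ of $L^2(G)$. The Gelfand character of $G$ is $\chi_G=\sum_{k=1}^r\chi_k$, the sum of all irreducible complex characters of $G$. *)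

theory Defs
  imports Complex_Main "HOL-Algebra.Group_Action" "Jordan_Normal_Form.VS_Connect"
begin

section \<open>Operators on complex vector spaces\<close>

text \<open>
  A complex vector space is a module record \<open>V\<close> with \<open>vectorspace class_ring V\<close>, where
  \<^term>\<open>class_ring :: complex ring\<close> is the field of complex numbers. Operators are extensional on
  the carrier, as in \<^const>\<open>Bij\<close> and \<^const>\<open>BijGroup\<close>, so that equality of operators is
  equality in HOL; correspondingly operators are composed with \<^const>\<open>compose\<close>.
\<close>

definition lin_endos :: "(complex, 'v) module \<Rightarrow> ('v \<Rightarrow> 'v) set" where
  "lin_endos V = LinearCombinations.module_hom class_ring V V \<inter> extensional (carrier V)"

definition lin_autos :: "(complex, 'v) module \<Rightarrow> ('v \<Rightarrow> 'v) set" where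
  "lin_autos V = LinearCombinations.module_hom class_ring V V \<inter> Bij (carrier V)"

definition coordinates :: "(complex, 'v) module \<Rightarrow> 'v set \<Rightarrow> 'v \<Rightarrow> 'v \<Rightarrow> complex" where
  "coordinates V B v = (THE a. a \<in> B \<rightarrow>\<^sub>E UNIV \<and> module.lincomb V a B = v)"

text \<open>Meaningful for finite-dimensional spaces, where the value does not depend on the basis chosen.\<close>

definition op_trace :: "(complex, 'v) module \<Rightarrow> ('v \<Rightarrow> 'v) \<Rightarrow> complex" where
  "op_trace V A =
     (let B = (SOME B. finite B \<and> vectorspace.basis class_ring V B)
      in \<Sum>v\<in>B. coordinates V B (A v) v)"

text \<open>Positivity suffices for the real part: \<open>ip u u\<close> is real by conjugate symmetry.\<close>

locale inner_product_on =
  fixes V :: "(complex, 'v) module" (structure) and ip :: "'v \<Rightarrow> 'v \<Rightarrow> complex"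
  assumes add_left: "\<lbrakk>u \<in> carrier V; v \<in> carrier V; w \<in> carrier V\<rbrakk> \<Longrightarrow>
      ip (u \<oplus> v) w = ip u w + ip v w"
    and smult_left: "\<lbrakk>u \<in> carrier V; v \<in> carrier V\<rbrakk> \<Longrightarrow> ip (c \<odot>\<^bsub>V\<^esub> u) v = c * ip u v"
    and conj_sym: "\<lbrakk>u \<in> carrier V; v \<in> carrier V\<rbrakk> \<Longrightarrow> ip v u = cnj (ip u v)"
    and pos_def: "\<lbrakk>u \<in> carrier V; u \<noteq> \<zero>\<rbrakk> \<Longrightarrow> Re (ip u u) > 0"

definition orthonormal_basis ::
  "(complex, 'v) module \<Rightarrow> ('v \<Rightarrow> 'v \<Rightarrow> complex) \<Rightarrow> (nat \<Rightarrow> 'v) \<Rightarrow> bool" where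
  "orthonormal_basis V ip b \<longleftrightarrow>
     (let n = vectorspace.dim class_ring V in
        vectorspace.basis class_ring V (b ` {1..n}) \<and>
        (\<forall>i\<in>{1..n}. \<forall>j\<in>{1..n}. ip (b i) (b j) = (if i = j then 1 else 0)))"


section \<open>Representations\<close>

text \<open>
  \<^const>\<open>group_action\<close> says that \<open>\<pi>\<close> is a group homomorphism into the group of bijections of
  the carrier; together with linearity, a homomorphism into \<open>Aut(V)\<close>.
\<close>

locale linear_rep =
  fixes G :: "('g, 'z) monoid_scheme" and V :: "(complex, 'v) module"
    and \<pi> :: "'g \<Rightarrow> 'v \<Rightarrow> 'v"
  assumes vectorspace: "vectorspace class_ring V"
    and action: "group_action G (carrier V) \<pi>"
    and linear: "g \<in> carrier G \<Longrightarrow> \<pi> g \<in> lin_autos V"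

locale irreducible_unitary_rep = linear_rep G V \<pi> + inner_product_on V ip
  for G :: "('g, 'z) monoid_scheme" and V :: "(complex, 'v) module"
    and ip :: "'v \<Rightarrow> 'v \<Rightarrow> complex" and \<pi> :: "'g \<Rightarrow> 'v \<Rightarrow> 'v" +
  assumes fin_dim: "vectorspace.fin_dim class_ring V"
    and unitary: "\<lbrakk>g \<in> carrier G; u \<in> carrier V; v \<in> carrier V\<rbrakk> \<Longrightarrow>
      ip (\<pi> g u) (\<pi> g v) = ip u v"
    and nonzero: "carrier V \<noteq> {\<zero>\<^bsub>V\<^esub>}"
    and irreducible: "\<lbrakk>VectorSpace.subspace class_ring W V; \<And>g w. \<lbrakk>g \<in> carrier G; w \<in> W\<rbrakk> \<Longrightarrow> \<pi> g w \<in> W\<rbrakk> \<Longrightarrow>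
      W = {\<zero>\<^bsub>V\<^esub>} \<or> W = carrier V"

definition isomorphic_reps ::
  "('g, 'z) monoid_scheme \<Rightarrow> (complex, 'v) module \<Rightarrow> ('g \<Rightarrow> 'v \<Rightarrow> 'v) \<Rightarrow>
   (complex, 'w) module \<Rightarrow> ('g \<Rightarrow> 'w \<Rightarrow> 'w) \<Rightarrow> bool" where
  "isomorphic_reps G V \<pi> W \<sigma> \<longleftrightarrow>
     (\<exists>\<phi> \<in> LinearCombinations.module_hom class_ring V W. bij_betw \<phi> (carrier V) (carrier W) \<and>
        (\<forall>g\<in>carrier G. \<forall>v\<in>carrier V. \<phi> (\<pi> g v) = \<sigma> g (\<phi> v)))"

text \<open>
  The list \<open>(U 1, \<pi> 1), \<dots>, (U r, \<pi> r)\<close> contains each irreducible unitary representation exactly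
  once up to isomorphism. HOL cannot quantify over the type of the representation space in
  \<open>exhaustive\<close>; it ranges over the representations on the spaces \<open>\<complex>\<^sup>m\<close> with the standard inner
  product. This is no restriction, because every finite-dimensional complex inner product space
  is isometric to some \<open>\<complex>\<^sup>m\<close>.
\<close>

locale all_irreps =
  fixes G :: "('g, 'z) monoid_scheme" and r :: nat
    and U :: "nat \<Rightarrow> (complex, 'v) module" and ip :: "nat \<Rightarrow> 'v \<Rightarrow> 'v \<Rightarrow> complex"
    and \<pi> :: "nat \<Rightarrow> 'g \<Rightarrow> 'v \<Rightarrow> 'v"
  assumes irrep: "k \<in> {1..r} \<Longrightarrow> irreducible_unitary_rep G (U k) (ip k) (\<pi> k)"
    and pairwise_nonisomorphic: "\<lbrakk>k \<in> {1..r}; l \<in> {1..r}; k \<noteq> l\<rbrakk> \<Longrightarrow>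
      \<not> isomorphic_reps G (U k) (\<pi> k) (U l) (\<pi> l)"
    and exhaustive:
      "irreducible_unitary_rep G (module_vec TYPE(complex) m) (\<lambda>u v. u \<bullet>c v) \<sigma> \<Longrightarrow>
      \<exists>k\<in>{1..r}. isomorphic_reps G (module_vec TYPE(complex) m) \<sigma> (U k) (\<pi> k)"

definition gelfand_character ::
  "nat \<Rightarrow> (nat \<Rightarrow> (complex, 'v) module) \<Rightarrow> (nat \<Rightarrow> 'g \<Rightarrow> 'v \<Rightarrow> 'v) \<Rightarrow> 'g \<Rightarrow> complex" where
  "gelfand_character r U \<pi> g = (\<Sum>k=1..r. op_trace (U k) (\<pi> k g))"


section \<open>The space of functions on the group\<close>

definition L2 :: "('g, 'z) monoid_scheme \<Rightarrow> (complex, 'g \<Rightarrow> complex) module" where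
  "L2 G = ring.func_space class_ring (carrier G)"

definition right_regular ::
  "('g, 'z) monoid_scheme \<Rightarrow> 'g \<Rightarrow> ('g \<Rightarrow> complex) \<Rightarrow> 'g \<Rightarrow> complex" where
  "right_regular G g = (\<lambda>f\<in>carrier (L2 G). \<lambda>h\<in>carrier G. f (h \<otimes>\<^bsub>G\<^esub> g))"

text \<open>
  The entry \<open>(i, j)\<close> of the matrix of \<open>\<pi> g\<close> in the basis \<open>b\<close> is the \<open>b i\<close>-coordinate of
  \<open>\<pi> g (b j)\<close>.
\<close>

definition matrix_coeff ::
  "('g, 'z) monoid_scheme \<Rightarrow> (complex, 'v) module \<Rightarrow> ('g \<Rightarrow> 'v \<Rightarrow> 'v) \<Rightarrow> (nat \<Rightarrow> 'v) \<Rightarrow>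
   nat \<Rightarrow> nat \<Rightarrow> 'g \<Rightarrow> complex" where
  "matrix_coeff G V \<pi> b i j =
     (\<lambda>g\<in>carrier G. coordinates V (b ` {1..vectorspace.dim class_ring V}) (\<pi> g (b j)) (b i))"

definition transposes_coeffs ::
  "('g, 'z) monoid_scheme \<Rightarrow> nat \<Rightarrow> (nat \<Rightarrow> (complex, 'v) module) \<Rightarrow>
   (nat \<Rightarrow> 'g \<Rightarrow> 'v \<Rightarrow> 'v) \<Rightarrow> (nat \<Rightarrow> nat \<Rightarrow> 'v) \<Rightarrow>
   (('g \<Rightarrow> complex) \<Rightarrow> 'g \<Rightarrow> complex) \<Rightarrow> bool" where
  "transposes_coeffs G r U \<pi> b T \<longleftrightarrow>
     T \<in> lin_endos (L2 G) \<and>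
     (\<forall>k\<in>{1..r}. \<forall>i\<in>{1..vectorspace.dim class_ring (U k)}.
        \<forall>j\<in>{1..vectorspace.dim class_ring (U k)}.
          T (matrix_coeff G (U k) (\<pi> k) (b k) i j) = matrix_coeff G (U k) (\<pi> k) (b k) j i)"

abbreviation L2_comp ::
  "('g, 'z) monoid_scheme \<Rightarrow> (('g \<Rightarrow> complex) \<Rightarrow> 'g \<Rightarrow> complex) \<Rightarrow>
   (('g \<Rightarrow> complex) \<Rightarrow> 'g \<Rightarrow> complex) \<Rightarrow> ('g \<Rightarrow> complex) \<Rightarrow> 'g \<Rightarrow> complex" where
  "L2_comp G A B \<equiv> compose (carrier (L2 G)) A B"

definition conj_regular ::
  "('g, 'z) monoid_scheme \<Rightarrow> (('g \<Rightarrow> complex) \<Rightarrow> 'g \<Rightarrow> complex) \<Rightarrow>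
   'g \<Rightarrow> ('g \<Rightarrow> complex) \<Rightarrow> 'g \<Rightarrow> complex" where
  "conj_regular G T g = L2_comp G T (L2_comp G (right_regular G g) T)"

end

theory Submission
  imports Defs "Jordan_Normal_Form.Spectral_Radius"
begin

text \<open>
  Everything is checked on the basis of matrix coefficients. From
  \<open>\<rho>\<^sub>g e\<^sub>i\<^sub>j = (\<Sum>l. e\<^sub>l\<^sub>j(g) e\<^sub>i\<^sub>l)\<close> the right regular representation acts on the second index
  only, so its conjugate by the transposition \<open>T\<close> acts on the first index only and the two
  commute; and \<open>\<rho>\<^sub>g (T e\<^sub>i\<^sub>j) = (\<Sum>l. e\<^sub>l\<^sub>i(g) e\<^sub>j\<^sub>l)\<close> contributes to the trace only if \<open>i = j = l\<close>.

  That the coefficients form a basis is the Peter-Weyl theorem for finite groups. Independence is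
  Schur orthogonality, obtained by applying Schur's lemma to averaged sesquilinear forms. For
  completeness, a minimal nonzero invariant subspace of the orthogonal complement of the
  coefficients would be an irreducible representation; evaluating its elements at \<open>\<one>\<close> exhibits them
  as combinations of the coefficients they are orthogonal to.
\<close>


section \<open>Coordinates and traces\<close>

text \<open>Almost every identity is tested through scalar functionals: inner products, point
  evaluations, coordinates, Fourier coefficients. They are plain functions satisfying
  \<open>linear_on\<close>, so sums in a module turn into complex sums and one expansion argument
  serves all of them. Schur's lemma is phrased with sesquilinear forms for the same reason: an
  averaged form is a sum of numbers, and its values at basis vectors are inner products of matrix
  coefficients. A map between two representation spaces is built only where an isomorphism has to be
  exhibited, by Riesz representation.

  The minimal invariant subspace exists because orthonormal families have bounded length; their
  maximal length in a subspace plays the role of its dimension and decreases strictly under proper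
  inclusion.

  The inner product on functions carries no factor 1/|G|. A matrix coefficient of a representation
  of dimension n therefore has squared norm |G|/n, and the functional dual to it carries the
  constant n/|G|.\<close>

definition linear_on :: "(complex, 'v) module \<Rightarrow> ('v \<Rightarrow> complex) \<Rightarrow> bool" where
  "linear_on V L \<longleftrightarrow>
     (\<forall>u\<in>carrier V. \<forall>v\<in>carrier V. L (u \<oplus>\<^bsub>V\<^esub> v) = L u + L v) \<and>
     (\<forall>c. \<forall>v\<in>carrier V. L (c \<odot>\<^bsub>V\<^esub> v) = c * L v)"

lemma linear_on_hom:
  assumes "\<phi> \<in> LinearCombinations.module_hom class_ring V W" and "linear_on W L"
  shows "linear_on V (\<lambda>v. L (\<phi> v))"
  using assms unfolding linear_on_def LinearCombinations.module_hom_def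
  by (auto simp: Pi_iff)

locale complex_vectorspace = vectorspace "class_ring :: complex ring" V
  for V :: "(complex, 'v) module" (structure)
begin

lemma smult_closed' [simp, intro]: "v \<in> carrier V \<Longrightarrow> c \<odot>\<^bsub>V\<^esub> v \<in> carrier V"
  by (simp add: smult_closed)

lemma smult_zero_left: "v \<in> carrier V \<Longrightarrow> 0 \<odot>\<^bsub>V\<^esub> v = \<zero>"
  using lmult_0 by simp

lemma linear_on_finsum:
  assumes L: "linear_on V L" and f: "f \<in> A \<rightarrow> carrier V"
  shows "L (finsum V f A) = (\<Sum>a\<in>A. L (f a))"
proof -
  have "L (0 \<odot>\<^bsub>V\<^esub> \<zero>) = 0 * L \<zero>"
    using L M.zero_closed unfolding linear_on_def by blast
  then have zero: "L \<zero> = 0"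
    using M.zero_closed by (simp add: smult_zero_left)
  show ?thesis
    using f
  proof (induction A rule: infinite_finite_induct)
    \<comment> \<open>On an infinite index set \<open>finsum\<close> and \<open>sum\<close> both
      take their default value zero, so this case only says that \<open>L\<close> maps zero to
      zero.\<close>
    case (infinite A)
    then show ?case
      by (simp add: zero finsum_infinite)
  next
    case empty
    then show ?case by (simp add: zero)
  next
    case (insert a A)
    then have "f a \<in> carrier V" "finsum V f A \<in> carrier V"
      by auto
    with insert L show ?case
      by (simp add: linear_on_def)
  qed
qed

lemma linear_on_lincomb:
  assumes "linear_on V L" and "A \<subseteq> carrier V"
  shows "L (lincomb a A) = (\<Sum>v\<in>A. a v * L v)"
proof -
  have "L (lincomb a A) = (\<Sum>v\<in>A. L (a v \<odot>\<^bsub>V\<^esub> v))"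
    unfolding lincomb_def by (rule linear_on_finsum) (use assms in auto)
  also have "\<dots> = (\<Sum>v\<in>A. a v * L v)"
    using assms by (intro sum.cong) (auto simp: linear_on_def)
  finally show ?thesis .
qed

lemma lincomb_coordinates:
  assumes "finite B" "basis B" "v \<in> carrier V"
  shows "lincomb (coordinates V B v) B = v"
proof -
  have "B \<subseteq> carrier V" using assms(2) by (simp add: basis_def)
  then have "\<exists>!a. a \<in> B \<rightarrow>\<^sub>E UNIV \<and> lincomb a B = v"
    using basis_criterion[OF assms(1)] assms(2,3) by simp
  from theI'[OF this] show ?thesis
    unfolding coordinates_def by auto
qed

lemma coordinates_eqI:
  assumes "finite B" "basis B" "w \<in> B"
  shows "coordinates V B (lincomb a B) w = a w"
proof -
  have B: "B \<subseteq> carrier V" using assms(2) by (simp add: basis_def)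
  let ?v = "lincomb a B"
  have v: "?v \<in> carrier V" using B by auto
  then have ex1: "\<exists>!a. a \<in> B \<rightarrow>\<^sub>E UNIV \<and> lincomb a B = ?v"
    using basis_criterion[OF assms(1)] assms(2) B by simp
  \<comment> \<open>\<open>coordinates\<close> selects among functions extensional on
    \<open>B\<close>, so \<open>a\<close> is cut down to \<open>B\<close> before uniqueness can be
    applied.\<close>
  have "lincomb (restrict a B) B = ?v"
    using B by (intro lincomb_cong) auto
  then have "coordinates V B ?v = restrict a B"
    unfolding coordinates_def by (intro the1_equality[OF ex1]) auto
  then show ?thesis using assms(3) by simp
qed

lemma linear_on_coordinates:
  assumes B: "finite B" "basis B" and w: "w \<in> B"
  shows "linear_on V (\<lambda>v. coordinates V B v w)"
  unfolding linear_on_def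
proof (intro conjI ballI allI)
  have BV: "B \<subseteq> carrier V" using B by (simp add: basis_def)
  fix u v assume u: "u \<in> carrier V" and v: "v \<in> carrier V"
  let ?c = "coordinates V B"
  have "lincomb (\<lambda>x. ?c u x + ?c v x) B = u \<oplus> v"
    using lincomb_sum[OF B(1) BV, of "?c u" "?c v"] lincomb_coordinates[OF B] u v by simp
  then show "?c (u \<oplus> v) w = ?c u w + ?c v w"
    using coordinates_eqI[OF B w] by metis
next
  have BV: "B \<subseteq> carrier V" using B by (simp add: basis_def)
  let ?c = "coordinates V B"
  fix c v assume v: "v \<in> carrier V"
  have "lincomb (\<lambda>x. c * ?c v x) B = c \<odot>\<^bsub>V\<^esub> v"
    using lincomb_smult[OF BV, of "?c v" c] lincomb_coordinates[OF B] v by simp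
  then show "?c (c \<odot>\<^bsub>V\<^esub> v) w = c * ?c v w"
    using coordinates_eqI[OF B w] by metis
qed

lemma linear_on_basis_expansion:
  assumes "finite B" "basis B" "linear_on V L" "v \<in> carrier V"
  shows "L v = (\<Sum>w\<in>B. coordinates V B v w * L w)"
  using linear_on_lincomb[OF assms(3), of B "coordinates V B v"] lincomb_coordinates[OF assms(1,2,4)]
    assms(2) by (simp add: basis_def)

text \<open>Both traces equal the double sum of
  \<open>coordinates V B (A w) v * coordinates V C v w\<close>. One side arises by expanding
  \<open>v\<close> in \<open>C\<close> under the functional taking \<open>x\<close> to the
  \<open>v\<close>-coordinate of \<open>A x\<close>, the other by expanding \<open>A w\<close> in
  \<open>B\<close> under the \<open>w\<close>-coordinate with respect to \<open>C\<close>.\<close>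

lemma trace_basis_independent:
  assumes B: "finite B" "basis B" and C: "finite C" "basis C"
    and A: "A \<in> LinearCombinations.module_hom class_ring V V"
  shows "(\<Sum>v\<in>B. coordinates V B (A v) v) = (\<Sum>w\<in>C. coordinates V C (A w) w)"
proof -
  have BV: "\<And>v. v \<in> B \<Longrightarrow> v \<in> carrier V" and CV: "\<And>v. v \<in> C \<Longrightarrow> v \<in> carrier V"
    using B C by (auto simp: basis_def)
  have AV: "\<And>v. v \<in> carrier V \<Longrightarrow> A v \<in> carrier V"
    using LinearCombinations.module_hom_closed[OF A] by auto
  have "(\<Sum>v\<in>B. coordinates V B (A v) v) =
      (\<Sum>v\<in>B. \<Sum>w\<in>C. coordinates V C v w * coordinates V B (A w) v)"
    by (intro sum.cong refl linear_on_basis_expansion[OF C linear_on_hom[OF A linear_on_coordinates[OF B]]] BV)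
  also have "\<dots> = (\<Sum>w\<in>C. \<Sum>v\<in>B. coordinates V B (A w) v * coordinates V C v w)"
    by (subst sum.swap) (simp add: mult.commute)
  also have "\<dots> = (\<Sum>w\<in>C. coordinates V C (A w) w)"
    by (intro sum.cong refl linear_on_basis_expansion[OF B linear_on_coordinates[OF C], symmetric] AV CV)
  finally show ?thesis .
qed

text \<open>The basis inside \<open>op_trace\<close> comes from Hilbert choice. The given
  \<open>B\<close> witnesses that the choice is a finite basis, and basis independence then replaces
  it by \<open>B\<close>.\<close>

lemma op_trace_eq:
  assumes "finite B" "basis B" "A \<in> LinearCombinations.module_hom class_ring V V"
  shows "op_trace V A = (\<Sum>v\<in>B. coordinates V B (A v) v)"
proof -
  have "finite (SOME B. finite B \<and> basis B) \<and> basis (SOME B. finite B \<and> basis B)"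
    by (rule someI[of "\<lambda>B. finite B \<and> basis B" B]) (use assms in auto)
  then show ?thesis
    unfolding op_trace_def Let_def using trace_basis_independent assms by blast
qed

text \<open>The criterion by which bases are recognised here: duality yields independence, the
  expansion yields spanning, and the functionals turn out to be the coordinates. It is applied to
  indicator functions with point evaluations and to matrix coefficients with Fourier coefficients.
  Injectivity of the indexing comes from duality, since a repeated vector would give 0 = 1.\<close>

lemma
  assumes I: "finite I" and e: "e \<in> I \<rightarrow> carrier V"
    and L: "\<And>i. i \<in> I \<Longrightarrow> linear_on V (L i)"
    and dual: "\<And>i j. i \<in> I \<Longrightarrow> j \<in> I \<Longrightarrow> L i (e j) = (if i = j then 1 else 0)"
    and span: "\<And>v. v \<in> carrier V \<Longrightarrow> v = (\<Oplus>\<^bsub>V\<^esub>i\<in>I. L i v \<odot>\<^bsub>V\<^esub> e i)"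
  shows dual_family_inj: "inj_on e I" and dual_family_is_basis: "basis (e ` I)"
    and dual_family_coordinates: "v \<in> carrier V \<Longrightarrow> i \<in> I \<Longrightarrow> coordinates V (e ` I) v (e i) = L i v"
proof -
  show inj: "inj_on e I"
    by (rule inj_onI) (metis dual zero_neq_one)
  have eV: "e ` I \<subseteq> carrier V" using e by auto
  have lc: "lincomb a (e ` I) = (\<Oplus>\<^bsub>V\<^esub>i\<in>I. a (e i) \<odot>\<^bsub>V\<^esub> e i)" for a
    unfolding lincomb_def using inj e by (intro finsum_reindex) auto
  have Llc: "L i (lincomb a (e ` I)) = a (e i)" if "i \<in> I" for i a
  proof -
    have "L i (lincomb a (e ` I)) = (\<Sum>w\<in>e ` I. a w * L i w)"
      by (rule linear_on_lincomb[OF L[OF that] eV])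
    also have "\<dots> = (\<Sum>j\<in>I. a (e j) * (if i = j then 1 else 0))"
      using dual that by (simp add: sum.reindex[OF inj])
    also have "\<dots> = a (e i)"
      using that I by (simp add: if_distrib sum.delta cong: if_cong)
    finally show ?thesis .
  qed
  \<comment> \<open>The only possible coordinate function: by \<open>Llc\<close>, a linear
    combination equal to \<open>v\<close> must have coefficient \<open>L i v\<close> at
    \<open>e i\<close>. The index is recovered from the vector by injectivity.\<close>
  let ?a = "\<lambda>v. \<lambda>w\<in>e ` I. L (the_inv_into I e w) v"
  have lca: "lincomb (?a v) (e ` I) = v" if "v \<in> carrier V" for v
  proof -
    have "lincomb (?a v) (e ` I) = (\<Oplus>\<^bsub>V\<^esub>i\<in>I. L i v \<odot>\<^bsub>V\<^esub> e i)"
      unfolding lc by (intro finsum_cong2) (use e inj in \<open>auto simp: the_inv_into_f_f\<close>)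
    then show ?thesis using span[OF that] by simp
  qed
  show basis: "basis (e ` I)"
  proof (subst basis_criterion)
    show "\<forall>v. v \<in> carrier V \<longrightarrow>
      (\<exists>!a. a \<in> e ` I \<rightarrow>\<^sub>E carrier class_ring \<and> lincomb a (e ` I) = v)"
    proof (intro allI impI ex1I[of _ "?a v" for v] conjI)
      fix v a assume v: "v \<in> carrier V"
        and a: "a \<in> e ` I \<rightarrow>\<^sub>E carrier class_ring \<and> lincomb a (e ` I) = v"
      show "a = ?a v"
      proof (rule extensionalityI[of _ "e ` I"])
        fix w assume "w \<in> e ` I"
        then show "a w = ?a v w"
          using Llc[of _ a] a inj by (auto simp: the_inv_into_f_f)
      qed (use a in \<open>auto simp: PiE_def\<close>)
    qed (use lca in auto)
  qed (use I eV in auto)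
  show "coordinates V (e ` I) v (e i) = L i v" if "v \<in> carrier V" "i \<in> I"
    using coordinates_eqI[OF _ basis, of "e i" "coordinates V (e ` I) v"] that I
      Llc[OF that(2), of "coordinates V (e ` I) v"] lincomb_coordinates[OF _ basis that(1)] by simp
qed

end


section \<open>Schur's lemma and orthogonality of matrix coefficients\<close>

lemma (in complex_vectorspace) subspaceI:
  assumes "N \<subseteq> carrier V" "\<zero> \<in> N" "\<And>u v. u \<in> N \<Longrightarrow> v \<in> N \<Longrightarrow> u \<oplus> v \<in> N"
    and "\<And>c v. v \<in> N \<Longrightarrow> c \<odot>\<^bsub>V\<^esub> v \<in> N"
  shows "VectorSpace.subspace class_ring N V"
  by (intro VectorSpace.subspace.intro submodule.intro)
    (use assms module_axioms vectorspace_axioms in auto)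

lemma linear_on_sum:
  assumes "\<And>a. a \<in> A \<Longrightarrow> linear_on V (L a)"
  shows "linear_on V (\<lambda>v. \<Sum>a\<in>A. L a v)"
  using assms by (simp add: linear_on_def sum.distrib sum_distrib_left)

lemma linear_on_mult_left: "linear_on V L \<Longrightarrow> linear_on V (\<lambda>v. k * L v)"
  by (simp add: linear_on_def algebra_simps)

lemma linear_on_mult_right: "linear_on V L \<Longrightarrow> linear_on V (\<lambda>v. L v * k)"
  by (simp add: linear_on_def algebra_simps)

lemma linear_on_diff: "linear_on V L \<Longrightarrow> linear_on V K \<Longrightarrow> linear_on V (\<lambda>v. L v - K v)"
  by (simp add: linear_on_def algebra_simps)

lemma (in complex_vectorspace) linear_on_cong:
  assumes "linear_on V K" and "\<And>v. v \<in> carrier V \<Longrightarrow> L v = K v"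
  shows "linear_on V L"
  using assms by (simp add: linear_on_def)

section \<open>Unitary irreducible representations with an orthonormal basis\<close>

locale onb_rep = group G + irreducible_unitary_rep G V ip \<pi>
  for G :: "('g, 'z) monoid_scheme" (structure) and V :: "(complex, 'v) module" and ip \<pi> +
  fixes b :: "nat \<Rightarrow> 'v"
  assumes onb: "orthonormal_basis V ip b"
begin

sublocale V: complex_vectorspace V
  by (simp add: complex_vectorspace_def vectorspace)

abbreviation n :: nat where "n \<equiv> V.dim"

text \<open>The matrix entry in row \<open>i\<close> and column \<open>j\<close>: in an orthonormal
  basis the \<open>b i\<close>-coordinate is the inner product with \<open>b i\<close>, as
  \<open>coordinates_b\<close> confirms.\<close>

abbreviation coeff :: "nat \<Rightarrow> nat \<Rightarrow> 'g \<Rightarrow> complex" where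
  "coeff i j g \<equiv> ip (\<pi> g (b j)) (b i)"

lemma basis_b: "V.basis (b ` {1..n})"
  and ip_b: "i \<in> {1..n} \<Longrightarrow> j \<in> {1..n} \<Longrightarrow> ip (b i) (b j) = (if i = j then 1 else 0)"
  using onb by (auto simp: orthonormal_basis_def Let_def)

lemma b_carrier [simp]: "i \<in> {1..n} \<Longrightarrow> b i \<in> carrier V"
  using basis_b by (auto simp: V.basis_def)

lemma inj_b: "inj_on b {1..n}"
  by (rule inj_onI) (metis ip_b zero_neq_one)

lemma linear_on_ip: "u \<in> carrier V \<Longrightarrow> linear_on V (\<lambda>v. ip v u)"
  by (simp add: linear_on_def add_left smult_left)

lemma coordinates_b:
  assumes "v \<in> carrier V" "i \<in> {1..n}"
  shows "coordinates V (b ` {1..n}) v (b i) = ip v (b i)"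
proof -
  have "ip v (b i) = (\<Sum>w\<in>b ` {1..n}. coordinates V (b ` {1..n}) v w * ip w (b i))"
    using assms by (intro V.linear_on_basis_expansion basis_b linear_on_ip) auto
  also have "\<dots> = (\<Sum>j\<in>{1..n}. coordinates V (b ` {1..n}) v (b j) * (if j = i then 1 else 0))"
    unfolding sum.reindex[OF inj_b] using assms ip_b by (intro sum.cong) auto
  also have "\<dots> = coordinates V (b ` {1..n}) v (b i)"
    using assms(2) by (simp add: if_distrib cong: if_cong)
  finally show ?thesis by simp
qed

lemma linear_on_expansion:
  assumes "linear_on V L" "v \<in> carrier V"
  shows "L v = (\<Sum>i\<in>{1..n}. ip v (b i) * L (b i))"
proof -
  have "L v = (\<Sum>w\<in>b ` {1..n}. coordinates V (b ` {1..n}) v w * L w)"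
    using assms by (intro V.linear_on_basis_expansion basis_b) auto
  also have "\<dots> = (\<Sum>i\<in>{1..n}. ip v (b i) * L (b i))"
    unfolding sum.reindex[OF inj_b] using assms coordinates_b by (intro sum.cong) auto
  finally show ?thesis .
qed

lemma ip_zero_left: "v \<in> carrier V \<Longrightarrow> ip \<zero>\<^bsub>V\<^esub> v = 0"
  using smult_left[of "\<zero>\<^bsub>V\<^esub>" v 0] by (simp add: V.smult_zero_left)

lemma eq_zeroI:
  assumes "v \<in> carrier V" "\<And>i. i \<in> {1..n} \<Longrightarrow> ip v (b i) = 0"
  shows "v = \<zero>\<^bsub>V\<^esub>"
proof (rule ccontr)
  assume "v \<noteq> \<zero>\<^bsub>V\<^esub>"
  then have "Re (ip v v) > 0" using pos_def assms by simp
  moreover have "ip v v = 0"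
    using linear_on_expansion[OF linear_on_ip, of v v] assms by simp
  ultimately show False by simp
qed

text \<open>Nondegeneracy. It is the means by which linearity and equivariance of a Riesz map are
  read off from the form that it represents.\<close>

lemma ip_ext:
  assumes v: "v \<in> carrier V" and w: "w \<in> carrier V" and eq: "\<And>u. u \<in> carrier V \<Longrightarrow> ip v u = ip w u"
  shows "v = w"
proof -
  have m: "\<ominus>\<^bsub>V\<^esub> w = (- 1) \<odot>\<^bsub>V\<^esub> w"
    using V.smult_minus_1[OF w] by (simp add: class_ring_simps)
  have "v \<oplus>\<^bsub>V\<^esub> (- 1) \<odot>\<^bsub>V\<^esub> w = \<zero>\<^bsub>V\<^esub>"
    using v w eq by (intro eq_zeroI) (simp_all add: add_left smult_left)
  then have "v \<ominus>\<^bsub>V\<^esub> w = \<zero>\<^bsub>V\<^esub>"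
    unfolding a_minus_def m .
  then show ?thesis
    using v w by simp
qed

text \<open>Needed to obtain an eigenvalue of an n by n matrix and to divide by n in the
  orthogonality relations.\<close>

lemma dim_pos: "0 < n"
proof (rule ccontr)
  assume "\<not> 0 < n"
  then have "v = \<zero>\<^bsub>V\<^esub>" if "v \<in> carrier V" for v
    using that by (intro eq_zeroI) auto
  then show False using nonzero V.M.zero_closed by blast
qed

text \<open>The vector representing a conjugate-linear functional. Since \<open>ip\<close> is linear
  in its first argument, \<open>ip (riesz L) u\<close> is conjugate-linear in \<open>u\<close>;
  hence the coefficients \<open>L (b i)\<close> occur unconjugated and \<open>ip_riesz\<close> asks
  for linearity of the conjugate of \<open>L\<close>.\<close>

definition riesz :: "('v \<Rightarrow> complex) \<Rightarrow> 'v" where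
  "riesz L = (\<Oplus>\<^bsub>V\<^esub>i\<in>{1..n}. L (b i) \<odot>\<^bsub>V\<^esub> b i)"

lemma riesz_carrier: "riesz L \<in> carrier V"
  unfolding riesz_def by (rule V.finsum_closed) (auto simp del: atLeastAtMost_iff)

lemma ip_riesz:
  assumes L: "linear_on V (\<lambda>u. cnj (L u))" and u: "u \<in> carrier V"
  shows "ip (riesz L) u = L u"
proof -
  have "ip (riesz L) u = (\<Sum>i\<in>{1..n}. ip (L (b i) \<odot>\<^bsub>V\<^esub> b i) u)"
    unfolding riesz_def
    by (rule V.linear_on_finsum[OF linear_on_ip[OF u]]) (auto simp del: atLeastAtMost_iff)
  also have "\<dots> = (\<Sum>i\<in>{1..n}. L (b i) * ip (b i) u)"
    using u by (intro sum.cong refl smult_left) auto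
  also have "\<dots> = (\<Sum>i\<in>{1..n}. L (b i) * cnj (ip u (b i)))"
    using u by (intro sum.cong refl arg_cong2[of _ _ _ _ "(*)"] conj_sym) auto
  also have "\<dots> = cnj (\<Sum>i\<in>{1..n}. ip u (b i) * cnj (L (b i)))"
    by (simp add: mult.commute)
  also have "\<dots> = L u"
    using linear_on_expansion[OF L u] by (metis complex_cnj_cnj)
  finally show ?thesis .
qed

lemma rep_hom: "g \<in> carrier G \<Longrightarrow> \<pi> g \<in> LinearCombinations.module_hom class_ring V V"
  using linear by (simp add: lin_autos_def)

lemma rep_carrier: "g \<in> carrier G \<Longrightarrow> v \<in> carrier V \<Longrightarrow> \<pi> g v \<in> carrier V"
  using LinearCombinations.module_hom_closed[OF rep_hom] by auto

lemma rep_mult: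
  "g \<in> carrier G \<Longrightarrow> h \<in> carrier G \<Longrightarrow> v \<in> carrier V \<Longrightarrow> \<pi> (g \<otimes> h) v = \<pi> g (\<pi> h v)"
  using group_action.composition_rule[OF action] by simp

lemma rep_one: "v \<in> carrier V \<Longrightarrow> \<pi> \<one> v = v"
  using group_action.id_eq_one[OF action] by (metis restrict_apply')

lemma rep_inv: "g \<in> carrier G \<Longrightarrow> v \<in> carrier V \<Longrightarrow> \<pi> g (\<pi> (inv g) v) = v"
  by (metis rep_mult rep_one r_inv inv_closed)

lemma coeff_mult:
  assumes "g \<in> carrier G" "h \<in> carrier G" "i \<in> {1..n}" "j \<in> {1..n}"
  shows "coeff i j (g \<otimes> h) = (\<Sum>l\<in>{1..n}. coeff i l g * coeff l j h)"
proof -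
  have "ip (\<pi> g (\<pi> h (b j))) (b i) = (\<Sum>l\<in>{1..n}. coeff l j h * coeff i l g)"
    using assms
    by (intro linear_on_expansion linear_on_hom[OF rep_hom linear_on_ip] rep_carrier) auto
  then show ?thesis
    using assms by (simp add: rep_mult mult.commute del: atLeastAtMost_iff)
qed

lemma coeff_one: "i \<in> {1..n} \<Longrightarrow> j \<in> {1..n} \<Longrightarrow> coeff i j \<one> = (if i = j then 1 else 0)"
  using ip_b rep_one by auto

lemma coeff_inv:
  assumes "g \<in> carrier G" "i \<in> {1..n}" "j \<in> {1..n}"
  shows "coeff i j (inv g) = cnj (coeff j i g)"
proof -
  \<comment> \<open>By unitarity \<open>\<pi> g\<close> may be applied in both slots; in the first
    it cancels the inverse.\<close>
  have "coeff i j (inv g) = ip (\<pi> g (\<pi> (inv g) (b j))) (\<pi> g (b i))"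
    using assms by (intro unitary[symmetric] rep_carrier) auto
  also have "\<dots> = cnj (coeff j i g)"
    using assms conj_sym[of "\<pi> g (b i)" "b j"]
    by (simp add: rep_inv rep_carrier del: atLeastAtMost_iff)
  finally show ?thesis .
qed

end

text \<open>Invariant sesquilinear forms, conjugate-linear in the second argument; conjugating the
  value expresses this through \<open>linear_on\<close>. By Riesz representation they correspond to
  intertwiners from \<open>V\<close> to \<open>W\<close>.\<close>

definition invariant_form ::
  "('g, 'z) monoid_scheme \<Rightarrow> (complex, 'v) module \<Rightarrow> ('g \<Rightarrow> 'v \<Rightarrow> 'v) \<Rightarrow>
   (complex, 'w) module \<Rightarrow> ('g \<Rightarrow> 'w \<Rightarrow> 'w) \<Rightarrow> ('v \<Rightarrow> 'w \<Rightarrow> complex) \<Rightarrow> bool" where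
  "invariant_form G V \<pi> W \<sigma> F \<longleftrightarrow>
     (\<forall>u\<in>carrier W. linear_on V (\<lambda>v. F v u)) \<and>
     (\<forall>v\<in>carrier V. linear_on W (\<lambda>u. cnj (F v u))) \<and>
     (\<forall>g\<in>carrier G. \<forall>v\<in>carrier V. \<forall>u\<in>carrier W. F (\<pi> g v) (\<sigma> g u) = F v u)"

context onb_rep
begin

text \<open>The left kernel of \<open>F\<close> against the test set \<open>C\<close> is an
  invariant subspace, so by irreducibility a nonzero member makes it everything. Invariance of the
  kernel only requires that a group element acting on the first argument can be absorbed by changing
  the test vector, which is what \<open>inv\<close> provides.\<close>

lemma form_kernel:
  assumes F: "\<And>u. u \<in> C \<Longrightarrow> linear_on V (\<lambda>v. F v u)"
    and inv: "\<And>g v u. g \<in> carrier G \<Longrightarrow> v \<in> carrier V \<Longrightarrow> u \<in> C \<Longrightarrow> \<exists>u'\<in>C. F (\<pi> g v) u = F v u'"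
    and v: "v \<in> carrier V" "v \<noteq> \<zero>\<^bsub>V\<^esub>" "\<And>u. u \<in> C \<Longrightarrow> F v u = 0"
    and w: "w \<in> carrier V" "u \<in> C"
  shows "F w u = 0"
proof -
  let ?N = "{v \<in> carrier V. \<forall>u\<in>C. F v u = 0}"
  have z: "F \<zero>\<^bsub>V\<^esub> u = 0" if "u \<in> C" for u
  proof -
    have "F (0 \<odot>\<^bsub>V\<^esub> v) u = 0 * F v u"
      using F[OF that] v unfolding linear_on_def by blast
    then show ?thesis using v by (simp add: V.smult_zero_left)
  qed
  have "VectorSpace.subspace class_ring ?N V"
    by (rule V.subspaceI) (use F z in \<open>auto simp: linear_on_def\<close>)
  moreover have "\<pi> g x \<in> ?N" if "g \<in> carrier G" "x \<in> ?N" for g x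
    using that inv[of g x] rep_carrier by force
  ultimately have "?N = {\<zero>\<^bsub>V\<^esub>} \<or> ?N = carrier V"
    by (rule irreducible)
  then show ?thesis
    using v w by blast
qed

text \<open>
  The intertwiner of Schur's lemma is \<open>v \<mapsto> \<phi> v\<close> with \<open>ipW (\<phi> v) u = F v u\<close>; its linearity and
  equivariance are read off from those of \<open>F\<close>.
\<close>

lemma nonzero_invariant_form_iso:
  assumes W: "onb_rep G W ipW \<sigma> c"
    and F: "invariant_form G V \<pi> W \<sigma> F"
    and nz: "v0 \<in> carrier V" "u0 \<in> carrier W" "F v0 u0 \<noteq> 0"
  shows "isomorphic_reps G V \<pi> W \<sigma>"
proof -
  interpret W: onb_rep G W ipW \<sigma> c by fact
  have linV: "linear_on V (\<lambda>v. F v u)" if "u \<in> carrier W" for u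
    using F that by (auto simp: invariant_form_def)
  have linW: "linear_on W (\<lambda>u. cnj (F v u))" if "v \<in> carrier V" for v
    using F that by (auto simp: invariant_form_def)
  have inv: "F (\<pi> g v) (\<sigma> g u) = F v u" if "g \<in> carrier G" "v \<in> carrier V" "u \<in> carrier W" for g v u
    using F that by (auto simp: invariant_form_def)
  \<comment> \<open>Putting \<open>\<sigma> (inv g) u\<close> for \<open>u\<close> in the invariance
    moves the action to the second argument, the shape that \<open>form_kernel\<close>
    expects.\<close>
  have inv': "F (\<pi> g v) u = F v (\<sigma> (inv g) u)"
    if "g \<in> carrier G" "v \<in> carrier V" "u \<in> carrier W" for g v u
    using inv[of g v "\<sigma> (inv g) u"] that by (simp add: W.rep_carrier W.rep_inv)
  have inv'_ex: "\<exists>u'\<in>carrier W. F (\<pi> g v) u = F v u'"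
    if "g \<in> carrier G" "v \<in> carrier V" "u \<in> carrier W" for g v u
    using inv'[OF that] W.rep_carrier[of "inv g" u] that by auto
  define \<phi> where "\<phi> v = W.riesz (F v)" for v
  have \<phi>W: "\<phi> v \<in> carrier W" for v
    unfolding \<phi>_def by (rule W.riesz_carrier)
  have ip\<phi>: "ipW (\<phi> v) u = F v u" if "v \<in> carrier V" "u \<in> carrier W" for v u
    unfolding \<phi>_def using that by (intro W.ip_riesz linW)
  have add: "\<phi> (u \<oplus>\<^bsub>V\<^esub> v) = \<phi> u \<oplus>\<^bsub>W\<^esub> \<phi> v" if "u \<in> carrier V" "v \<in> carrier V" for u v
    using that linV \<phi>W by (intro W.ip_ext) (auto simp: ip\<phi> W.add_left linear_on_def)
  have smult: "\<phi> (r \<odot>\<^bsub>V\<^esub> v) = r \<odot>\<^bsub>W\<^esub> \<phi> v" if "v \<in> carrier V" for r v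
    using that linV \<phi>W by (intro W.ip_ext) (auto simp: ip\<phi> W.smult_left linear_on_def)
  have hom: "\<phi> \<in> LinearCombinations.module_hom class_ring V W"
    unfolding LinearCombinations.module_hom_def using add smult \<phi>W by auto
  have inter: "\<phi> (\<pi> g v) = \<sigma> g (\<phi> v)" if "g \<in> carrier G" "v \<in> carrier V" for g v
  proof (rule W.ip_ext)
    fix u assume u: "u \<in> carrier W"
    have "ipW (\<phi> (\<pi> g v)) u = ipW (\<phi> v) (\<sigma> (inv g) u)"
      using that u by (simp add: ip\<phi> rep_carrier W.rep_carrier inv')
    also have "\<dots> = ipW (\<sigma> g (\<phi> v)) (\<sigma> g (\<sigma> (inv g) u))"
      using that u \<phi>W by (intro W.unitary[symmetric] W.rep_carrier) auto
    also have "\<dots> = ipW (\<sigma> g (\<phi> v)) u"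
      using that u by (simp add: W.rep_inv)
    finally show "ipW (\<phi> (\<pi> g v)) u = ipW (\<sigma> g (\<phi> v)) u" .
  qed (use that \<phi>W W.rep_carrier in auto)
  have sub: "x \<ominus>\<^bsub>V\<^esub> y = x \<oplus>\<^bsub>V\<^esub> (- 1) \<odot>\<^bsub>V\<^esub> y" if "y \<in> carrier V" for x y
    using V.smult_minus_1[OF that] by (simp add: class_ring_simps a_minus_def)
  \<comment> \<open>If \<open>\<phi> x = \<phi> y\<close>, then the difference of \<open>x\<close>
    and \<open>y\<close> lies in the left kernel of \<open>F\<close>; were it nonzero,
    \<open>form_kernel\<close> would force \<open>F v0 u0 = 0\<close>.\<close>
  have "inj_on \<phi> (carrier V)"
  proof (rule inj_onI, rule ccontr)
    fix x y assume xy: "x \<in> carrier V" "y \<in> carrier V" "\<phi> x = \<phi> y" "x \<noteq> y"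
    let ?d = "x \<ominus>\<^bsub>V\<^esub> y"
    have Fd: "F ?d u = 0" if "u \<in> carrier W" for u
    proof -
      have "F ?d u = F x u + (- 1) * F y u"
        using linV[OF that] xy unfolding sub[OF xy(2)] by (simp add: linear_on_def)
      then show ?thesis
        using xy that ip\<phi> by (metis add.right_inverse mult_minus1)
    qed
    have d: "?d \<in> carrier V" "?d \<noteq> \<zero>\<^bsub>V\<^esub>"
      using xy by auto
    have "F v0 u0 = 0"
      by (rule form_kernel[where C = "carrier W" and F = F, OF linV inv'_ex d Fd nz(1,2)])
    then show False using nz by simp
  qed
  \<comment> \<open>Surjectivity uses irreducibility of \<open>W\<close>: the image is an invariant
    subspace, and \<open>F v0 u0\<close> being nonzero keeps it from being trivial.\<close>
  moreover have "\<phi> ` carrier V = carrier W"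
  proof -
    have "VectorSpace.subspace class_ring (\<phi> ` carrier V) W"
    proof (rule W.V.subspaceI)
      show "\<zero>\<^bsub>W\<^esub> \<in> \<phi> ` carrier V"
        using smult[of "\<zero>\<^bsub>V\<^esub>" 0] \<phi>W by (metis V.M.zero_closed V.smult_zero_left W.V.smult_zero_left imageI)
    next
      fix u v assume "u \<in> \<phi> ` carrier V" "v \<in> \<phi> ` carrier V"
      then show "u \<oplus>\<^bsub>W\<^esub> v \<in> \<phi> ` carrier V"
        by (auto simp: add[symmetric])
    next
      fix r v assume "v \<in> \<phi> ` carrier V"
      then show "r \<odot>\<^bsub>W\<^esub> v \<in> \<phi> ` carrier V"
        by (auto simp: smult[symmetric])
    qed (use \<phi>W in auto)
    moreover have "\<sigma> g w \<in> \<phi> ` carrier V" if "g \<in> carrier G" "w \<in> \<phi> ` carrier V" for g w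
      using that by (auto simp: inter[symmetric] rep_carrier)
    ultimately have "\<phi> ` carrier V = {\<zero>\<^bsub>W\<^esub>} \<or> \<phi> ` carrier V = carrier W"
      by (rule W.irreducible)
    moreover have "\<phi> v0 \<noteq> \<zero>\<^bsub>W\<^esub>"
      using nz ip\<phi> W.ip_zero_left by metis
    ultimately show ?thesis using nz by blast
  qed
  ultimately have "bij_betw \<phi> (carrier V) (carrier W)"
    by (simp add: bij_betw_def)
  with hom inter show ?thesis
    unfolding isomorphic_reps_def by blast
qed

text \<open>Schur's lemma for one representation. Over the complex numbers \<open>F\<close> has an
  eigenvalue \<open>k\<close> relative to \<open>ip\<close>. Then \<open>F - k * ip\<close> is
  invariant and has a nonzero vector in its left kernel, so it vanishes by
  \<open>form_kernel\<close>.\<close>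

lemma invariant_form_scalar:
  assumes F: "invariant_form G V \<pi> V \<pi> F"
  shows "\<exists>k. \<forall>v\<in>carrier V. \<forall>u\<in>carrier V. F v u = k * ip v u"
proof -
  have linV: "linear_on V (\<lambda>v. F v u)" if "u \<in> carrier V" for u
    using F that by (auto simp: invariant_form_def)
  have linV2: "linear_on V (\<lambda>u. cnj (F v u))" if "v \<in> carrier V" for v
    using F that by (auto simp: invariant_form_def)
  have inv: "F (\<pi> g v) (\<pi> g u) = F v u" if "g \<in> carrier G" "v \<in> carrier V" "u \<in> carrier V" for g v u
    using F that by (auto simp: invariant_form_def)
  \<comment> \<open>The row index sits in the second argument of \<open>F\<close>, so that
    \<open>M\<close> times the coordinate vector of \<open>v\<close> lists the values
    \<open>F v (b i)\<close>. \<open>Suc\<close> converts matrix indices, counted from 0, to basis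
    indices, counted from 1.\<close>
  define M where "M = mat n n (\<lambda>(i, p). F (b (Suc p)) (b (Suc i)))"
  have M: "M \<in> carrier_mat n n" by (simp add: M_def)
  from spectrum_non_empty[OF M dim_pos] obtain k c where c: "c \<in> carrier_vec n" "c \<noteq> 0\<^sub>v n"
    "M *\<^sub>v c = k \<cdot>\<^sub>v c"
    using M by (auto simp: spectrum_def eigenvalue_def eigenvector_def)
  \<comment> \<open>The vector with coordinates \<open>c\<close> in the basis \<open>b\<close>,
    obtained as the Riesz vector of its own inner products.\<close>
  define v where "v = riesz (\<lambda>u. \<Sum>p\<in>{1..n}. c $ (p - 1) * ip (b p) u)"
  have v: "v \<in> carrier V" unfolding v_def by (rule riesz_carrier)
  have ipv: "ip v u = (\<Sum>p\<in>{1..n}. c $ (p - 1) * ip (b p) u)" if "u \<in> carrier V" for u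
    unfolding v_def
  proof (rule ip_riesz[OF _ that])
    have "linear_on V (\<lambda>u. \<Sum>p\<in>{1..n}. cnj (c $ (p - 1)) * ip u (b p))"
      by (intro linear_on_sum linear_on_mult_left linear_on_ip b_carrier)
    moreover have "cnj (\<Sum>p\<in>{1..n}. c $ (p - 1) * ip (b p) u) =
      (\<Sum>p\<in>{1..n}. cnj (c $ (p - 1)) * ip u (b p))" if "u \<in> carrier V" for u
      unfolding cnj_sum using that
      by (intro sum.cong refl) (simp add: conj_sym[of "b _" u] del: atLeastAtMost_iff)
    ultimately show "linear_on V (\<lambda>u. cnj (\<Sum>p\<in>{1..n}. c $ (p - 1) * ip (b p) u))"
      by (rule V.linear_on_cong)
  qed
  have ipvb: "ip v (b i) = c $ (i - 1)" if "i \<in> {1..n}" for i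
  proof -
    have "ip v (b i) = (\<Sum>p\<in>{1..n}. c $ (p - 1) * (if p = i then 1 else 0))"
      unfolding ipv[OF b_carrier[OF that]] using that by (intro sum.cong refl) (simp add: ip_b del: atLeastAtMost_iff)
    then show ?thesis using that by (simp add: if_distrib cong: if_cong)
  qed
  have v0: "v \<noteq> \<zero>\<^bsub>V\<^esub>"
  proof
    assume "v = \<zero>\<^bsub>V\<^esub>"
    then have "c $ i = 0" if "i < n" for i
      using ipvb[of "Suc i"] that ip_zero_left[OF b_carrier, of "Suc i"] by simp
    then have "c = 0\<^sub>v n"
      using c(1) by auto
    then show False using c(2) by simp
  qed
  have Fvb: "F v (b i) = k * ip v (b i)" if "i \<in> {1..n}" for i
  proof -
    have "F v (b i) = (\<Sum>p\<in>{1..n}. c $ (p - 1) * F (b p) (b i))"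
      using that ipvb linear_on_expansion[OF linV v, of "b i"] by simp
    also have "\<dots> = (\<Sum>p\<in>{0..<n}. c $ p * F (b (Suc p)) (b i))"
      by (rule sum.reindex_bij_witness[where i = Suc and j = "\<lambda>p. p - 1"]) auto
    also have "\<dots> = (M *\<^sub>v c) $ (i - 1)"
      using that c(1) by (cases i) (auto simp: M_def scalar_prod_def mult.commute intro!: sum.cong)
    also have "\<dots> = k * ip v (b i)"
      using that c(1) by (cases i) (auto simp: c(3) ipvb)
    finally show ?thesis .
  qed
  define D where "D v u = F v u - k * ip v u" for v u
  have linD: "linear_on V (\<lambda>v. D v u)" if "u \<in> carrier V" for u
    unfolding D_def using that by (intro linear_on_diff linear_on_mult_left linV linear_on_ip)
  have linD2: "linear_on V (\<lambda>u. cnj (D v u))" if "v \<in> carrier V" for v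
  proof (rule V.linear_on_cong)
    show "linear_on V (\<lambda>u. cnj (F v u) - cnj k * ip u v)"
      using that by (intro linear_on_diff linear_on_mult_left linV2 linear_on_ip)
    show "cnj (D v u) = cnj (F v u) - cnj k * ip u v" if "u \<in> carrier V" for u
      using that \<open>v \<in> carrier V\<close> conj_sym[of v u] by (simp add: D_def)
  qed
  \<comment> \<open>The eigenvalue equation gives \<open>D v (b i) = 0\<close> for each
    \<open>i\<close>. As \<open>D v\<close> is conjugate-linear, this spreads to all
    \<open>u\<close> by expanding the conjugate.\<close>
  have Dv: "D v u = 0" if "u \<in> carrier V" for u
  proof -
    have "cnj (D v u) = 0"
      using linear_on_expansion[OF linD2[OF v] that] Fvb by (simp add: D_def)
    then show ?thesis by simp
  qed
  have Dinv: "D (\<pi> g v) u = D v (\<pi> (inv g) u)"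
    if "g \<in> carrier G" "v \<in> carrier V" "u \<in> carrier V" for g v u
    using inv[of g v "\<pi> (inv g) u"] unitary[of g v "\<pi> (inv g) u"] that
    by (simp add: D_def rep_carrier rep_inv)
  have Dinv_ex: "\<exists>u'\<in>carrier V. D (\<pi> g v) u = D v u'"
    if "g \<in> carrier G" "v \<in> carrier V" "u \<in> carrier V" for g v u
    using Dinv[OF that] rep_carrier[of "inv g" u] that by auto
  have "D w u = 0" if "w \<in> carrier V" "u \<in> carrier V" for w u
    by (rule form_kernel[where C = "carrier V" and F = D, OF linD Dinv_ex v v0 Dv that])
  then show ?thesis
    by (auto simp: D_def)
qed

text \<open>The sum over the group of the translates of the rank-one form sending \<open>v\<close>,
  \<open>u\<close> to \<open>ip v x * cnj (ipW u y)\<close>. With basis vectors in all four places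
  it is the inner product of two matrix coefficients.\<close>

definition averaged_form ::
    "('w \<Rightarrow> 'w \<Rightarrow> complex) \<Rightarrow> ('g \<Rightarrow> 'w \<Rightarrow> 'w) \<Rightarrow> 'v \<Rightarrow> 'w \<Rightarrow> 'v \<Rightarrow> 'w \<Rightarrow> complex" where
  "averaged_form ipW \<sigma> x y v u = (\<Sum>g\<in>carrier G. ip (\<pi> g v) x * cnj (ipW (\<sigma> g u) y))"

lemma averaged_form_invariant:
  assumes W: "onb_rep G W ipW \<sigma> c" and fin: "finite (carrier G)"
    and x: "x \<in> carrier V" and y: "y \<in> carrier W"
  shows "invariant_form G V \<pi> W \<sigma> (averaged_form ipW \<sigma> x y)"
proof -
  interpret W: onb_rep G W ipW \<sigma> c by fact
  have lx: "linear_on V (\<lambda>v. ip (\<pi> g v) x)" if "g \<in> carrier G" for g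
    by (rule linear_on_hom[OF rep_hom[OF that] linear_on_ip[OF x]])
  have ly: "linear_on W (\<lambda>v. ipW (\<sigma> g v) y)" if "g \<in> carrier G" for g
    by (rule linear_on_hom[OF W.rep_hom[OF that] W.linear_on_ip[OF y]])
  show ?thesis
    unfolding invariant_form_def
  proof (intro conjI ballI)
    fix u assume "u \<in> carrier W"
    show "linear_on V (\<lambda>v. averaged_form ipW \<sigma> x y v u)"
      unfolding averaged_form_def by (intro linear_on_sum linear_on_mult_right lx)
  next
    fix v assume "v \<in> carrier V"
    show "linear_on W (\<lambda>u. cnj (averaged_form ipW \<sigma> x y v u))"
      unfolding averaged_form_def cnj_sum complex_cnj_mult complex_cnj_cnj
      by (intro linear_on_sum linear_on_mult_left ly)
  next
    fix h v u assume h: "h \<in> carrier G" and v: "v \<in> carrier V" and u: "u \<in> carrier W"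
    have "averaged_form ipW \<sigma> x y (\<pi> h v) (\<sigma> h u) =
      (\<Sum>g\<in>carrier G. ip (\<pi> (g \<otimes> h) v) x * cnj (ipW (\<sigma> (g \<otimes> h) u) y))"
      unfolding averaged_form_def using h v u by (intro sum.cong refl) (simp add: rep_mult W.rep_mult)
    also have "\<dots> = averaged_form ipW \<sigma> x y v u"
      unfolding averaged_form_def
      by (rule sum.reindex_bij_witness[where i = "\<lambda>g. g \<otimes> inv h" and j = "\<lambda>g. g \<otimes> h"])
        (use h in \<open>auto simp: m_assoc\<close>)
    finally show "averaged_form ipW \<sigma> x y (\<pi> h v) (\<sigma> h u) = averaged_form ipW \<sigma> x y v u" .
  qed
qed

text \<open>The sum is a value of an averaged form, and a nonzero invariant form would make the two
  representations isomorphic.\<close>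

lemma coeff_orthogonal:
  assumes W: "onb_rep G W ipW \<sigma> c" and fin: "finite (carrier G)"
    and niso: "\<not> isomorphic_reps G V \<pi> W \<sigma>"
    and ij: "i \<in> {1..n}" "j \<in> {1..n}" "p \<in> {1..vectorspace.dim class_ring W}" "q \<in> {1..vectorspace.dim class_ring W}"
  shows "(\<Sum>g\<in>carrier G. coeff i j g * cnj (ipW (\<sigma> g (c q)) (c p))) = 0"
proof -
  interpret W: onb_rep G W ipW \<sigma> c by fact
  have "averaged_form ipW \<sigma> (b i) (c p) (b j) (c q) = 0"
    using nonzero_invariant_form_iso[OF W averaged_form_invariant[OF W fin]] niso ij
      b_carrier W.b_carrier by blast
  then show ?thesis by (simp add: averaged_form_def)
qed

text \<open>By Schur's lemma the averaged form for \<open>b i\<close> and \<open>b p\<close> is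
  \<open>k * ip\<close>, which settles the dependence on the column indices. It remains to find
  \<open>k\<close>, which depends on \<open>i\<close> and \<open>p\<close> only.\<close>

lemma coeff_orthonormal:
  assumes fin: "finite (carrier G)"
    and ij: "i \<in> {1..n}" "j \<in> {1..n}" "p \<in> {1..n}" "q \<in> {1..n}"
  shows "(\<Sum>g\<in>carrier G. coeff i j g * cnj (coeff p q g)) =
    (if i = p \<and> j = q then of_nat (card (carrier G)) / of_nat n else 0)"
proof -
  have self: "onb_rep G V ip \<pi> b" ..
  let ?F = "averaged_form ip \<pi> (b i) (b p)"
  obtain k where k: "\<And>v u. v \<in> carrier V \<Longrightarrow> u \<in> carrier V \<Longrightarrow> ?F v u = k * ip v u"
    using invariant_form_scalar[OF averaged_form_invariant[OF self fin]] ij by (meson b_carrier)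
  have F: "(\<Sum>g\<in>carrier G. coeff i j g * cnj (coeff p q g)) = (if j = q then k else 0)"
    if "j \<in> {1..n}" "q \<in> {1..n}" for j q
    using k[of "b j" "b q"] that by (simp add: averaged_form_def ip_b del: atLeastAtMost_iff)
  \<comment> \<open>Summing over equal column indices determines \<open>k\<close>: the conjugate of
    \<open>coeff p j g\<close> is \<open>coeff j p (inv g)\<close>, so the sum over \<open>j\<close>
    is an entry of the matrix of \<open>g \<otimes> inv g\<close>, the identity.\<close>
  have "of_nat n * k = (\<Sum>j\<in>{1..n}. \<Sum>g\<in>carrier G. coeff i j g * cnj (coeff p j g))"
    using F by simp
  also have "\<dots> = (\<Sum>g\<in>carrier G. \<Sum>j\<in>{1..n}. coeff i j g * coeff j p (inv g))"
    using ij by (subst sum.swap) (simp add: coeff_inv del: atLeastAtMost_iff)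
  also have "\<dots> = (\<Sum>g\<in>carrier G. coeff i p (g \<otimes> inv g))"
    using ij by (intro sum.cong refl coeff_mult[symmetric]) auto
  also have "\<dots> = of_nat (card (carrier G)) * (if i = p then 1 else 0)"
    using ij coeff_one by (simp)
  finally have "of_nat n * k = of_nat (card (carrier G)) * (if i = p then 1 else 0)" .
  then have "k = (if i = p then of_nat (card (carrier G)) / of_nat n else 0)"
    using dim_pos by (auto simp: field_simps)
  then show ?thesis using F[OF ij(2,4)] by simp
qed

end


section \<open>Orthonormal families in subspaces\<close>

locale fin_dim_inner_product = complex_vectorspace V + inner_product_on V ip
  for V :: "(complex, 'v) module" (structure) and ip +
  assumes finite_dim: "fin_dim"
begin

definition orthonormal_family :: "'v set \<Rightarrow> nat \<Rightarrow> (nat \<Rightarrow> 'v) \<Rightarrow> bool" where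
  "orthonormal_family N m w \<longleftrightarrow>
     (\<forall>i<m. w i \<in> N) \<and> (\<forall>i<m. \<forall>j<m. ip (w i) (w j) = (if i = j then 1 else 0))"

definition proj :: "nat \<Rightarrow> (nat \<Rightarrow> 'v) \<Rightarrow> 'v \<Rightarrow> 'v" where
  "proj m w v = (\<Oplus>i\<in>{..<m}. ip v (w i) \<odot>\<^bsub>V\<^esub> w i)"

text \<open>For a subspace this is its dimension, measured inside the ambient space so that the
  subspace does not have to become a module record of its own.\<close>

definition rank :: "'v set \<Rightarrow> nat" where
  "rank N = Max {m. \<exists>w. orthonormal_family N m w}"

lemma linear_on_ip_left: "u \<in> carrier V \<Longrightarrow> linear_on V (\<lambda>v. ip v u)"
  by (simp add: linear_on_def add_left smult_left)

lemma subspace_carrier: "VectorSpace.subspace class_ring N V \<Longrightarrow> N \<subseteq> carrier V"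
  and subspace_zero: "VectorSpace.subspace class_ring N V \<Longrightarrow> \<zero> \<in> N"
  and subspace_add: "VectorSpace.subspace class_ring N V \<Longrightarrow> u \<in> N \<Longrightarrow> v \<in> N \<Longrightarrow> u \<oplus> v \<in> N"
  and subspace_smult: "VectorSpace.subspace class_ring N V \<Longrightarrow> v \<in> N \<Longrightarrow> c \<odot>\<^bsub>V\<^esub> v \<in> N"
  by (auto simp: VectorSpace.subspace_def submodule_def)

lemma subspace_finsum:
  assumes N: "VectorSpace.subspace class_ring N V" and "\<And>a. a \<in> A \<Longrightarrow> f a \<in> N"
  shows "finsum V f A \<in> N"
  using assms(2)
proof (induction A rule: infinite_finite_induct)
  case (insert a A)
  then have "f \<in> A \<rightarrow> carrier V" "f a \<in> carrier V"
    using subspace_carrier[OF N] by auto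
  with insert show ?case
    by (simp add: subspace_add[OF N])
qed (simp_all add: subspace_zero[OF N] finsum_infinite)

lemma subspace_diff:
  assumes N: "VectorSpace.subspace class_ring N V" and "u \<in> N" "v \<in> N"
  shows "u \<ominus> v \<in> N"
proof -
  have "v \<in> carrier V"
    using assms subspace_carrier by blast
  then have "\<ominus> v = (- 1) \<odot>\<^bsub>V\<^esub> v"
    using smult_minus_1[of v] by (simp add: class_ring_simps)
  then show ?thesis
    using assms by (simp add: a_minus_def subspace_add subspace_smult)
qed

lemma ip_diff_left:
  assumes "u \<in> carrier V" "v \<in> carrier V" "x \<in> carrier V"
  shows "ip (u \<ominus> v) x = ip u x - ip v x"
proof -
  have "\<ominus> v = (- 1) \<odot>\<^bsub>V\<^esub> v"
    using smult_minus_1[of v] assms by (simp add: class_ring_simps)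
  then show ?thesis
    using assms by (simp add: a_minus_def add_left smult_left)
qed

lemma ip_zero_left': "x \<in> carrier V \<Longrightarrow> ip \<zero> x = 0"
  using smult_left[of "\<zero>" x 0] by (simp add: smult_zero_left)

lemma orthonormal_family_le_dim:
  assumes "orthonormal_family (carrier V) m w"
  shows "m \<le> dim"
proof -
  have w: "w i \<in> carrier V" and ipw: "ip (w i) (w j) = (if i = j then 1 else 0)"
    if "i < m" "j < m" for i j
    using assms that by (auto simp: orthonormal_family_def)
  have inj: "inj_on w {..<m}"
    by (rule inj_onI) (metis ipw lessThan_iff zero_neq_one)
  have li: "lin_indpt (w ` {..<m})"
  proof (rule finite_lin_indpt2)
    fix a assume a: "lincomb a (w ` {..<m}) = \<zero>"
    show "\<forall>v\<in>w ` {..<m}. a v = \<zero>\<^bsub>class_ring\<^esub>"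
    proof
      fix v assume "v \<in> w ` {..<m}"
      then obtain j where j: "j < m" "v = w j" by auto
      have "0 = ip (lincomb a (w ` {..<m})) (w j)"
        using a j w ip_zero_left' by simp
      also have "\<dots> = (\<Sum>v\<in>w ` {..<m}. a v * ip v (w j))"
        using w j by (intro linear_on_lincomb linear_on_ip_left) auto
      also have "\<dots> = (\<Sum>i\<in>{..<m}. a (w i) * (if i = j then 1 else 0))"
        using ipw j by (simp add: sum.reindex[OF inj])
      also have "\<dots> = a v"
        using j by (simp add: if_distrib cong: if_cong)
      finally show "a v = \<zero>\<^bsub>class_ring\<^esub>" by simp
    qed
  qed (use w in auto)
  have "card (w ` {..<m}) \<le> dim"
    using li_le_dim[OF finite_dim _ li] w by auto
  then show ?thesis
    using card_image[OF inj] by simp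
qed

lemma finite_family_lengths:
  assumes "N \<subseteq> carrier V"
  shows "finite {m. \<exists>w. orthonormal_family N m w}"
proof (rule finite_subset)
  show "{m. \<exists>w. orthonormal_family N m w} \<subseteq> {..dim}"
    using orthonormal_family_le_dim assms unfolding orthonormal_family_def by blast
qed simp

lemma family_le_rank:
  assumes "N \<subseteq> carrier V" "orthonormal_family N m w"
  shows "m \<le> rank N"
  unfolding rank_def using finite_family_lengths[OF assms(1)] assms(2) by (intro Max_ge) auto

lemma rank_family_exists:
  assumes "N \<subseteq> carrier V"
  obtains w where "orthonormal_family N (rank N) w"
proof -
  have "orthonormal_family N 0 w" for w
    by (simp add: orthonormal_family_def)
  then have "rank N \<in> {m. \<exists>w. orthonormal_family N m w}"
    unfolding rank_def using finite_family_lengths[OF assms] by (intro Max_in) auto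
  then show ?thesis using that by auto
qed

text \<open>One Gram-Schmidt step: \<open>v\<close> minus its projection is nonzero and orthogonal
  to the family, and is normalised by \<open>c\<close>.\<close>

lemma orthonormal_family_extend:
  assumes N: "VectorSpace.subspace class_ring N V"
    and w: "orthonormal_family N m w" and v: "v \<in> N" "v \<noteq> proj m w v"
  shows "\<exists>w'. orthonormal_family N (Suc m) w'"
proof -
  have NV: "N \<subseteq> carrier V" by (rule subspace_carrier[OF N])
  have wN: "w i \<in> N" and ipw: "ip (w i) (w j) = (if i = j then 1 else 0)" if "i < m" "j < m" for i j
    using w that by (auto simp: orthonormal_family_def)
  let ?p = "proj m w v"
  have p: "?p \<in> N"
    unfolding proj_def using wN by (intro subspace_finsum[OF N] subspace_smult[OF N]) auto
  define u where "u = v \<ominus> ?p"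
  have u: "u \<in> N" "u \<in> carrier V"
    using subspace_diff[OF N v(1) p] NV by (auto simp: u_def)
  have u0: "u \<noteq> \<zero>"
    using v p NV by (auto simp: u_def subset_iff)
  have "ip ?p (w j) = ip v (w j)" if "j < m" for j
  proof -
    have "ip ?p (w j) = (\<Sum>i\<in>{..<m}. ip (ip v (w i) \<odot>\<^bsub>V\<^esub> w i) (w j))"
      unfolding proj_def using wN NV that by (intro linear_on_finsum linear_on_ip_left) auto
    also have "\<dots> = (\<Sum>i\<in>{..<m}. ip v (w i) * (if i = j then 1 else 0))"
      using wN NV ipw that by (intro sum.cong refl) (simp add: smult_left subset_iff)
    finally show ?thesis
      using that by (simp add: if_distrib cong: if_cong)
  qed
  then have uw: "ip u (w j) = 0" if "j < m" for j
    using v p wN NV that unfolding u_def by (subst ip_diff_left) auto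
  have wu: "ip (w j) u = 0" if "j < m" for j
    using uw[OF that] conj_sym[of u "w j"] u wN[OF that that] NV by auto
  define r where "r = Re (ip u u)"
  \<comment> \<open>\<open>pos_def\<close> speaks of the real part only; conjugate symmetry shows
    that the squared norm is real, so that its square root can be used for normalising.\<close>
  have "Im (ip u u) = - Im (ip u u)"
    using arg_cong[OF conj_sym[OF u(2) u(2)], of Im] by (simp only: cnj.simps(2))
  then have r: "ip u u = complex_of_real r" "r > 0"
    using pos_def[OF u(2) u0] by (simp_all add: complex_eq_iff r_def)
  define c where "c = complex_of_real (1 / sqrt r)"
  have smr: "ip x (c \<odot>\<^bsub>V\<^esub> u) = cnj c * ip x u" if "x \<in> carrier V" for x
    using that u conj_sym[of "c \<odot>\<^bsub>V\<^esub> u" x] conj_sym[of u x] by (simp add: smult_left)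
  have "c * (cnj c * ip u u) = of_real (1 / sqrt r * (1 / sqrt r * r))"
    unfolding c_def r(1) complex_cnj_complex_of_real by (simp only: of_real_mult)
  also have "\<dots> = 1"
    using r(2) by (simp add: field_simps)
  finally have "cnj c * (c * ip u u) = 1" by (simp only: mult.left_commute)
  then have "orthonormal_family N (Suc m) (w(m := c \<odot>\<^bsub>V\<^esub> u))"
    using u uw wu wN ipw NV
    by (auto simp: orthonormal_family_def less_Suc_eq smult_left smr subspace_smult[OF N] subset_iff)
  then show ?thesis by blast
qed

text \<open>A vector different from its projection would lengthen a family that already has maximal
  length.\<close>

lemma rank_family_expansion:
  assumes N: "VectorSpace.subspace class_ring N V"
    and w: "orthonormal_family N (rank N) w" and v: "v \<in> N"
  shows "v = proj (rank N) w v"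
proof (rule ccontr)
  assume "v \<noteq> proj (rank N) w v"
  then obtain w' where "orthonormal_family N (Suc (rank N)) w'"
    using orthonormal_family_extend[OF N w v] by blast
  from family_le_rank[OF subspace_carrier[OF N] this] show False by simp
qed

text \<open>A maximal family of \<open>N\<close> spans only vectors of \<open>N\<close>, so a vector
  of \<open>M\<close> outside \<open>N\<close> extends it within \<open>M\<close>.\<close>

lemma rank_strict_mono:
  assumes N: "VectorSpace.subspace class_ring N V" and M: "VectorSpace.subspace class_ring M V"
    and "N \<subset> M"
  shows "rank N < rank M"
proof -
  obtain w where w: "orthonormal_family N (rank N) w"
    using rank_family_exists[OF subspace_carrier[OF N]] .
  obtain v where v: "v \<in> M" "v \<notin> N" using assms by auto
  have "proj (rank N) w v \<in> N"
    unfolding proj_def using w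
    by (intro subspace_finsum[OF N] subspace_smult[OF N]) (auto simp: orthonormal_family_def)
  then have "v \<noteq> proj (rank N) w v" using v by auto
  moreover have "orthonormal_family M (rank N) w"
    using w assms(3) by (auto simp: orthonormal_family_def)
  ultimately obtain w' where "orthonormal_family M (Suc (rank N)) w'"
    using orthonormal_family_extend[OF M _ v(1)] by blast
  from family_le_rank[OF subspace_carrier[OF M] this] show ?thesis by simp
qed

end


section \<open>The right regular representation\<close>

lemma (in group) group_actionI:
  assumes E: "\<And>g. g \<in> carrier G \<Longrightarrow> \<phi> g \<in> E \<rightarrow>\<^sub>E E"
    and mult: "\<And>g h x. g \<in> carrier G \<Longrightarrow> h \<in> carrier G \<Longrightarrow> x \<in> E \<Longrightarrow> \<phi> (g \<otimes> h) x = \<phi> g (\<phi> h x)"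
    and one: "\<And>x. x \<in> E \<Longrightarrow> \<phi> \<one> x = x"
  shows "group_action G E \<phi>"
proof -
  have mem: "\<phi> g x \<in> E" if "g \<in> carrier G" "x \<in> E" for g x
    using E that by blast
  have Bij: "\<phi> g \<in> Bij E" if g: "g \<in> carrier G" for g
  proof -
    \<comment> \<open>Bijectivity comes from the group: \<open>\<phi> (inv g)\<close> inverts
      \<open>\<phi> g\<close> on both sides.\<close>
    have "bij_betw (\<phi> g) E E"
      by (rule bij_betw_byWitness[where f' = "\<phi> (inv g)"])
        (use g mem in \<open>auto simp: mult[symmetric] one\<close>)
    then show ?thesis
      using E[OF g] by (auto simp: Bij_def PiE_def)
  qed
  have "\<phi> (g \<otimes> h) = compose E (\<phi> g) (\<phi> h)" if "g \<in> carrier G" "h \<in> carrier G" for g h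
    by (rule extensionalityI[of _ E]) (use that E[of "g \<otimes> h"] mult in \<open>auto simp: compose_def PiE_def\<close>)
  then have "\<phi> \<in> hom G (BijGroup E)"
    using Bij by (auto simp: hom_def BijGroup_def)
  then show ?thesis
    by (simp add: group_action_def group_hom_def group_hom_axioms_def group_BijGroup is_group)
qed

lemma (in group) linear_repI:
  assumes "vectorspace class_ring V"
    and ext: "\<And>g. g \<in> carrier G \<Longrightarrow> \<phi> g \<in> extensional (carrier V)"
    and hom: "\<And>g. g \<in> carrier G \<Longrightarrow> \<phi> g \<in> LinearCombinations.module_hom class_ring V V"
    and mult: "\<And>g h x. g \<in> carrier G \<Longrightarrow> h \<in> carrier G \<Longrightarrow> x \<in> carrier V \<Longrightarrow> \<phi> (g \<otimes> h) x = \<phi> g (\<phi> h x)"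
    and one: "\<And>x. x \<in> carrier V \<Longrightarrow> \<phi> \<one> x = x"
  shows "linear_rep G V \<phi>"
proof (rule linear_rep.intro)
  show action: "group_action G (carrier V) \<phi>"
    by (rule group_actionI[OF _ mult one])
      (use ext LinearCombinations.module_hom_closed[OF hom] in \<open>auto simp: PiE_def\<close>)
  show "\<phi> g \<in> lin_autos V" if "g \<in> carrier G" for g
    using group_action.bij_prop0[OF action that] hom[OF that] ext[OF that]
    by (auto simp: lin_autos_def Bij_def)
qed (fact assms(1))

section \<open>Functions on the group as a finite-dimensional inner product space\<close>

lemma carrier_L2: "carrier (L2 G) = carrier G \<rightarrow>\<^sub>E UNIV"
  and add_L2: "f \<oplus>\<^bsub>L2 G\<^esub> h = (\<lambda>x\<in>carrier G. f x + h x)"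
  and zero_L2: "\<zero>\<^bsub>L2 G\<^esub> = (\<lambda>x\<in>carrier G. 0)"
  and smult_L2: "c \<odot>\<^bsub>L2 G\<^esub> f = (\<lambda>x\<in>carrier G. c * f x)"
  by (simp_all add: L2_def ring.func_space_def[OF class_ring.ring_axioms])

lemma L2_eqI:
  assumes "f \<in> carrier (L2 G)" "h \<in> carrier (L2 G)" "\<And>x. x \<in> carrier G \<Longrightarrow> f x = h x"
  shows "f = h"
  using assms by (auto simp: carrier_L2 intro: PiE_ext)

lemma vectorspace_L2: "vectorspace class_ring (L2 G)"
  unfolding vectorspace_def L2_def
  using class_cring.func_space_is_module class_field by blast

lemma complex_vectorspace_L2: "complex_vectorspace (L2 G)"
  by (simp add: complex_vectorspace_def vectorspace_L2)

definition L2_inner :: "('g, 'z) monoid_scheme \<Rightarrow> ('g \<Rightarrow> complex) \<Rightarrow> ('g \<Rightarrow> complex) \<Rightarrow> complex" where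
  "L2_inner G f h = (\<Sum>x\<in>carrier G. f x * cnj (h x))"

lemma linear_on_eval: "x \<in> carrier G \<Longrightarrow> linear_on (L2 G) (\<lambda>f. f x)"
  by (simp add: linear_on_def add_L2 smult_L2)

lemma finsum_L2:
  assumes "\<And>a. a \<in> A \<Longrightarrow> f a \<in> carrier (L2 G)" and "x \<in> carrier G"
  shows "finsum (L2 G) f A x = (\<Sum>a\<in>A. f a x)"
  by (rule complex_vectorspace.linear_on_finsum[OF complex_vectorspace_L2 linear_on_eval]) (use assms in auto)

text \<open>The indicator functions of points form a basis because the point evaluations are dual to
  them.\<close>

lemma fin_dim_L2:
  fixes G :: "('g, 'z) monoid_scheme"
  assumes fin: "finite (carrier G)"
  shows "vectorspace.fin_dim class_ring (L2 G)"
proof -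
  interpret L2: complex_vectorspace "L2 G" by (rule complex_vectorspace_L2)
  let ?e = "\<lambda>y. \<lambda>x\<in>carrier G. if x = y then 1 else 0 :: complex"
  have e: "?e \<in> carrier G \<rightarrow> carrier (L2 G)" by (auto simp: carrier_L2)
  have "L2.basis (?e ` carrier G)"
  proof (rule L2.dual_family_is_basis[where L = "\<lambda>x f. f x"])
    fix f :: "'g \<Rightarrow> complex" assume f: "f \<in> carrier (L2 G)"
    show "f = (\<Oplus>\<^bsub>L2 G\<^esub>i\<in>carrier G. f i \<odot>\<^bsub>L2 G\<^esub> ?e i)"
    proof (rule L2_eqI[OF f])
      show "(\<Oplus>\<^bsub>L2 G\<^esub>i\<in>carrier G. f i \<odot>\<^bsub>L2 G\<^esub> ?e i) \<in> carrier (L2 G)"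
        using e by (intro L2.finsum_closed) auto
      fix x assume x: "x \<in> carrier G"
      have "(\<Oplus>\<^bsub>L2 G\<^esub>i\<in>carrier G. f i \<odot>\<^bsub>L2 G\<^esub> ?e i) x = (\<Sum>i\<in>carrier G. (f i \<odot>\<^bsub>L2 G\<^esub> ?e i) x)"
        using e x by (intro finsum_L2) auto
      also have "\<dots> = (\<Sum>i\<in>carrier G. if x = i then f i else 0)"
        using x by (intro sum.cong refl) (simp add: smult_L2)
      also have "\<dots> = f x"
        using x fin by simp
      finally show "f x = (\<Oplus>\<^bsub>L2 G\<^esub>i\<in>carrier G. f i \<odot>\<^bsub>L2 G\<^esub> ?e i) x" by simp
    qed
  qed (use fin e linear_on_eval in auto)
  then show ?thesis
    using fin unfolding L2.fin_dim_def L2.basis_def by blast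
qed

lemma inner_product_L2:
  assumes fin: "finite (carrier G)"
  shows "inner_product_on (L2 G) (L2_inner G)"
proof
  interpret L2: complex_vectorspace "L2 G" by (rule complex_vectorspace_L2)
  fix f assume f: "f \<in> carrier (L2 G)" "f \<noteq> \<zero>\<^bsub>L2 G\<^esub>"
  then obtain x where x: "x \<in> carrier G" "f x \<noteq> 0"
    using L2_eqI[OF f(1) L2.zero_closed] by (auto simp: zero_L2)
  have "Re (L2_inner G f f) = (\<Sum>x\<in>carrier G. (cmod (f x))\<^sup>2)"
    unfolding L2_inner_def Re_sum by (simp add: complex_mult_cnj cmod_def)
  also have "\<dots> > 0"
    by (rule sum_pos2[OF fin x(1)]) (use x in auto)
  finally show "Re (L2_inner G f f) > 0" .
qed (simp_all add: L2_inner_def add_L2 smult_L2 sum.distrib sum_distrib_left algebra_simps)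

locale finite_group = group G for G :: "('g, 'z) monoid_scheme" (structure) +
  assumes finite_carrier: "finite (carrier G)"
begin

sublocale L2: fin_dim_inner_product "L2 G" "L2_inner G"
  by (intro fin_dim_inner_product.intro fin_dim_inner_product_axioms.intro
      inner_product_L2 finite_carrier fin_dim_L2 complex_vectorspace_L2)

abbreviation \<rho> :: "'g \<Rightarrow> ('g \<Rightarrow> complex) \<Rightarrow> 'g \<Rightarrow> complex" where "\<rho> \<equiv> right_regular G"

lemma right_regular_closed: "f \<in> carrier (L2 G) \<Longrightarrow> \<rho> g f \<in> carrier (L2 G)"
  by (simp add: right_regular_def carrier_L2)

lemma right_regular_apply: "f \<in> carrier (L2 G) \<Longrightarrow> x \<in> carrier G \<Longrightarrow> \<rho> g f x = f (x \<otimes> g)"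
  by (simp add: right_regular_def)

lemma right_regular_hom:
  assumes "g \<in> carrier G"
  shows "\<rho> g \<in> LinearCombinations.module_hom class_ring (L2 G) (L2 G)"
  unfolding LinearCombinations.module_hom_def
proof (intro CollectI conjI allI impI)
  show "\<rho> g \<in> carrier (L2 G) \<rightarrow> carrier (L2 G)"
    using right_regular_closed by auto
  fix f h assume "f \<in> carrier (L2 G) \<and> h \<in> carrier (L2 G)"
  then show "\<rho> g (f \<oplus>\<^bsub>L2 G\<^esub> h) = \<rho> g f \<oplus>\<^bsub>L2 G\<^esub> \<rho> g h"
    using assms
    by (intro L2_eqI[where G = G]) (simp_all add: right_regular_closed right_regular_apply, simp_all add: add_L2 right_regular_apply)
next
  fix c :: complex and f assume "c \<in> carrier class_ring \<and> f \<in> carrier (L2 G)"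
  then show "\<rho> g (c \<odot>\<^bsub>L2 G\<^esub> f) = c \<odot>\<^bsub>L2 G\<^esub> \<rho> g f"
    using assms
    by (intro L2_eqI[where G = G]) (simp_all add: right_regular_closed right_regular_apply, simp_all add: smult_L2 right_regular_apply)
qed

lemma right_regular_mult:
  assumes "g \<in> carrier G" "h \<in> carrier G" "f \<in> carrier (L2 G)"
  shows "\<rho> (g \<otimes> h) f = \<rho> g (\<rho> h f)"
  using assms by (intro L2_eqI[where G = G]) (simp_all add: right_regular_closed right_regular_apply m_assoc)

lemma right_regular_one: "f \<in> carrier (L2 G) \<Longrightarrow> \<rho> \<one> f = f"
  by (rule L2_eqI[where G = G]) (simp_all add: right_regular_closed right_regular_apply)

lemma right_regular_unitary:
  assumes "g \<in> carrier G" "f \<in> carrier (L2 G)" "h \<in> carrier (L2 G)"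
  shows "L2_inner G (\<rho> g f) (\<rho> g h) = L2_inner G f h"
  unfolding L2_inner_def
  by (rule sum.reindex_bij_witness[where i = "\<lambda>x. x \<otimes> inv g" and j = "\<lambda>x. x \<otimes> g"])
    (use assms in \<open>auto simp: m_assoc right_regular_apply\<close>)

section \<open>Minimal invariant subspaces\<close>

definition invariant :: "('g \<Rightarrow> complex) set \<Rightarrow> bool" where
  "invariant N \<longleftrightarrow> VectorSpace.subspace class_ring N (L2 G) \<and>
     (\<forall>g\<in>carrier G. \<forall>f\<in>N. \<rho> g f \<in> N)"

text \<open>Among the nonzero invariant subspaces of \<open>N\<close> one of least rank is minimal,
  since a proper nonzero invariant subspace of it would have smaller rank.\<close>

lemma minimal_invariant_exists:
  assumes "invariant N" "N \<noteq> {\<zero>\<^bsub>L2 G\<^esub>}"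
  obtains M where "invariant M" "M \<subseteq> N" "M \<noteq> {\<zero>\<^bsub>L2 G\<^esub>}"
    "\<And>K. invariant K \<Longrightarrow> K \<subseteq> M \<Longrightarrow> K = {\<zero>\<^bsub>L2 G\<^esub>} \<or> K = M"
proof -
  let ?P = "\<lambda>M. invariant M \<and> M \<subseteq> N \<and> M \<noteq> {\<zero>\<^bsub>L2 G\<^esub>}"
  obtain M where M: "?P M" and least: "\<And>K. ?P K \<Longrightarrow> L2.rank M \<le> L2.rank K"
    using ex_has_least_nat[of ?P N L2.rank] assms by blast
  have "K = {\<zero>\<^bsub>L2 G\<^esub>} \<or> K = M" if "invariant K" "K \<subseteq> M" for K
  proof (rule ccontr)
    assume "\<not> ?thesis"
    then have "?P K" "K \<subset> M" using that M by auto
    then show False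
      using least[of K] L2.rank_strict_mono[of K M] that M by (auto simp: invariant_def)
  qed
  with M that show ?thesis by blast
qed

end

section \<open>Transport of an invariant subspace to a standard space\<close>

lemma scalar_prod_conjugate_sum:
  fixes u v :: "complex vec"
  assumes "v \<in> carrier_vec m"
  shows "u \<bullet>c v = (\<Sum>i<m. u $ i * cnj (v $ i))"
  using assms by (simp add: scalar_prod_def atLeast0LessThan)

lemma inner_product_vec: "inner_product_on (module_vec TYPE(complex) m) (\<lambda>u v. u \<bullet>c v)"
proof
  fix u :: "complex vec"
  assume "u \<in> carrier (module_vec TYPE(complex) m)" "u \<noteq> \<zero>\<^bsub>module_vec TYPE(complex) m\<^esub>"
  then have u: "u \<in> carrier_vec m" "u \<noteq> 0\<^sub>v m"
    by (simp_all add: module_vec_simps)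
  then obtain i where i: "i < m" "u $ i \<noteq> 0"
    by (metis carrier_vecD eq_vecI index_zero_vec)
  have "Re (u \<bullet>c u) = (\<Sum>i<m. (cmod (u $ i))\<^sup>2)"
    unfolding scalar_prod_conjugate_sum[OF u(1)] Re_sum by (simp add: complex_mult_cnj cmod_def)
  also have "\<dots> > 0"
    by (rule sum_pos2[of _ i]) (use i in auto)
  finally show "Re (u \<bullet>c u) > 0" .
qed (simp_all add: module_vec_simps scalar_prod_conjugate_sum sum.distrib sum_distrib_left algebra_simps)

context finite_group
begin

text \<open>
  The list of irreducible representations is exhaustive only for the spaces \<open>\<complex>\<^sup>m\<close> with the standard
  inner product, so the invariant subspace is transported there along an orthonormal basis.
\<close>

lemma minimal_invariant_irreducible_rep:
  assumes N: "invariant N" "N \<noteq> {\<zero>\<^bsub>L2 G\<^esub>}"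
    and minimal: "\<And>K. invariant K \<Longrightarrow> K \<subseteq> N \<Longrightarrow> K = {\<zero>\<^bsub>L2 G\<^esub>} \<or> K = N"
  obtains m \<Theta> \<sigma> where
    "irreducible_unitary_rep G (module_vec TYPE(complex) m) (\<lambda>u v. u \<bullet>c v) \<sigma>"
    "\<Theta> \<in> LinearCombinations.module_hom class_ring (module_vec TYPE(complex) m) (L2 G)"
    "\<Theta> ` carrier (module_vec TYPE(complex) m) = N"
    "\<And>g c. g \<in> carrier G \<Longrightarrow> c \<in> carrier (module_vec TYPE(complex) m) \<Longrightarrow> \<Theta> (\<sigma> g c) = \<rho> g (\<Theta> c)"
proof -
  have sub: "VectorSpace.subspace class_ring N (L2 G)" and inv: "\<And>g f. g \<in> carrier G \<Longrightarrow> f \<in> N \<Longrightarrow> \<rho> g f \<in> N"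
    using N by (auto simp: invariant_def)
  have NL: "N \<subseteq> carrier (L2 G)" by (rule L2.subspace_carrier[OF sub])
  define m where "m = L2.rank N"
  obtain w where w: "L2.orthonormal_family N m w"
    using L2.rank_family_exists[OF NL] unfolding m_def .
  have wN: "w i \<in> N" and wL: "w i \<in> carrier (L2 G)" if "i < m" for i
    using w that NL by (auto simp: L2.orthonormal_family_def)
  have ipw: "L2_inner G (w i) (w j) = (if i = j then 1 else 0)" if "i < m" "j < m" for i j
    using w that by (auto simp: L2.orthonormal_family_def)
  have proj: "f = (\<Oplus>\<^bsub>L2 G\<^esub>i\<in>{..<m}. L2_inner G f (w i) \<odot>\<^bsub>L2 G\<^esub> w i)" if "f \<in> N" for f
    using L2.rank_family_expansion[OF sub w[unfolded m_def] that] by (simp add: L2.proj_def m_def)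

  let ?V = "module_vec TYPE(complex) m"
  \<comment> \<open>Synthesis \<open>\<Theta>\<close> and analysis \<open>\<Psi>\<close> with
    respect to a maximal orthonormal family of \<open>N\<close> are mutually inverse between the
    standard space and \<open>N\<close>, and \<open>\<Psi>\<close> is isometric on
    \<open>N\<close>.\<close>
  define \<Theta> :: "complex vec \<Rightarrow> _" where "\<Theta> c = (\<Oplus>\<^bsub>L2 G\<^esub>i\<in>{..<m}. c $ i \<odot>\<^bsub>L2 G\<^esub> w i)" for c
  define \<Psi> where "\<Psi> f = vec m (\<lambda>i. L2_inner G f (w i))" for f
  have \<Psi>V: "\<Psi> f \<in> carrier_vec m" for f by (simp add: \<Psi>_def)
  have \<Theta>N: "\<Theta> c \<in> N" for c
    unfolding \<Theta>_def using wN by (intro L2.subspace_finsum[OF sub] L2.subspace_smult[OF sub]) auto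
  have \<Theta>L: "\<Theta> c \<in> carrier (L2 G)" for c using \<Theta>N NL by auto
  have \<Theta>_apply: "\<Theta> c x = (\<Sum>i<m. c $ i * w i x)" if "x \<in> carrier G" for c x
  proof -
    have "\<Theta> c x = (\<Sum>i<m. (c $ i \<odot>\<^bsub>L2 G\<^esub> w i) x)"
      unfolding \<Theta>_def using wL that by (intro finsum_L2) auto
    then show ?thesis using that by (simp add: smult_L2)
  qed
  have \<Theta>\<Psi>: "\<Theta> (\<Psi> f) = f" if "f \<in> N" for f
  proof -
    have "\<Theta> (\<Psi> f) = (\<Oplus>\<^bsub>L2 G\<^esub>i\<in>{..<m}. L2_inner G f (w i) \<odot>\<^bsub>L2 G\<^esub> w i)"
      unfolding \<Theta>_def \<Psi>_def using wL by (intro L2.finsum_cong2) auto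
    then show ?thesis using proj[OF that] by simp
  qed
  have inner_\<Theta>: "L2_inner G (\<Theta> c) f = (\<Sum>i<m. c $ i * L2_inner G (w i) f)" if "f \<in> carrier (L2 G)" for c f
  proof -
    have "L2_inner G (\<Theta> c) f = (\<Sum>i<m. L2_inner G (c $ i \<odot>\<^bsub>L2 G\<^esub> w i) f)"
      unfolding \<Theta>_def using wL that by (intro L2.linear_on_finsum L2.linear_on_ip_left) auto
    then show ?thesis using wL that by (simp add: L2.smult_left)
  qed
  have \<Psi>\<Theta>: "\<Psi> (\<Theta> c) = c" if "c \<in> carrier_vec m" for c
  proof (rule eq_vecI)
    fix i assume "i < dim_vec c"
    then have i: "i < m" using that by simp
    have "\<Psi> (\<Theta> c) $ i = (\<Sum>j<m. c $ j * L2_inner G (w j) (w i))"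
      using i wL by (simp add: \<Psi>_def inner_\<Theta>)
    also have "\<dots> = (\<Sum>j<m. c $ j * (if j = i then 1 else 0))"
      using i ipw by (intro sum.cong refl) auto
    also have "\<dots> = c $ i"
      using i by (simp add: if_distrib cong: if_cong)
    finally show "\<Psi> (\<Theta> c) $ i = c $ i" .
  qed (use that in \<open>simp add: \<Psi>_def\<close>)
  have isom: "\<Psi> f \<bullet>c \<Psi> h = L2_inner G f h" if "f \<in> N" "h \<in> N" for f h
  proof -
    have "L2_inner G (\<Theta> (\<Psi> f)) h = (\<Sum>i<m. \<Psi> f $ i * L2_inner G (w i) h)"
      using that NL by (intro inner_\<Theta>) auto
    also have "\<dots> = (\<Sum>i<m. \<Psi> f $ i * cnj (\<Psi> h $ i))"
      using wL that NL by (intro sum.cong refl) (auto simp: \<Psi>_def L2.conj_sym[of h "w _"])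
    also have "\<dots> = \<Psi> f \<bullet>c \<Psi> h"
      by (simp add: scalar_prod_conjugate_sum[OF \<Psi>V])
    finally show ?thesis using that \<Theta>\<Psi> by simp
  qed
  have \<Theta>_add: "\<Theta> (c + d) = \<Theta> c \<oplus>\<^bsub>L2 G\<^esub> \<Theta> d" if "c \<in> carrier_vec m" "d \<in> carrier_vec m" for c d
  proof (rule L2_eqI[where G = G])
    show "\<Theta> (c + d) x = (\<Theta> c \<oplus>\<^bsub>L2 G\<^esub> \<Theta> d) x" if "x \<in> carrier G" for x
      using that \<open>c \<in> carrier_vec m\<close> \<open>d \<in> carrier_vec m\<close>
      by (simp add: add_L2 \<Theta>_apply sum.distrib ring_distribs)
  qed (use \<Theta>L in auto)
  have \<Theta>_smult: "\<Theta> (a \<cdot>\<^sub>v c) = a \<odot>\<^bsub>L2 G\<^esub> \<Theta> c" if "c \<in> carrier_vec m" for a c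
  proof (rule L2_eqI[where G = G])
    show "\<Theta> (a \<cdot>\<^sub>v c) x = (a \<odot>\<^bsub>L2 G\<^esub> \<Theta> c) x" if "x \<in> carrier G" for x
      using that \<open>c \<in> carrier_vec m\<close>
      by (simp add: smult_L2 \<Theta>_apply sum_distrib_left mult.assoc)
  qed (use \<Theta>L in auto)
  have \<Theta>_hom: "\<Theta> \<in> LinearCombinations.module_hom class_ring ?V (L2 G)"
    using \<Theta>L \<Theta>_add \<Theta>_smult
    by (auto simp: LinearCombinations.module_hom_def module_vec_simps)
  \<comment> \<open>Identities between vectors are from here on checked after applying the injective
    \<open>\<Theta>\<close>, which carries them to known identities for the right regular
    representation.\<close>
  have \<Theta>_eqI: "c = d" if "c \<in> carrier_vec m" "d \<in> carrier_vec m" "\<Theta> c = \<Theta> d" for c d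
    using that \<Psi>\<Theta> by metis
  have \<Theta>0: "\<Theta> (0\<^sub>v m) = \<zero>\<^bsub>L2 G\<^esub>"
    by (rule L2_eqI[where G = G]) (use \<Theta>L in \<open>simp_all add: \<Theta>_apply zero_L2 carrier_L2\<close>)
  have inj: "inj_on \<Theta> (carrier_vec m)"
    using \<Theta>_eqI by (rule inj_onI)
  have img: "\<Theta> ` carrier_vec m = N"
    using \<Theta>N \<Theta>\<Psi> \<Psi>V by (metis (no_types, lifting) image_subset_iff subset_antisym image_eqI subsetI)

  define \<sigma> where "\<sigma> g = (\<lambda>c\<in>carrier_vec m. \<Psi> (\<rho> g (\<Theta> c)))" for g
  have \<sigma>V: "\<sigma> g c \<in> carrier_vec m" if "c \<in> carrier_vec m" for g c
    using that by (simp add: \<sigma>_def \<Psi>V)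
  have \<Theta>\<sigma>: "\<Theta> (\<sigma> g c) = \<rho> g (\<Theta> c)" if "g \<in> carrier G" "c \<in> carrier_vec m" for g c
    using that by (simp add: \<sigma>_def \<Theta>\<Psi> inv \<Theta>N)
  have rho_add: "\<rho> g (f \<oplus>\<^bsub>L2 G\<^esub> h) = \<rho> g f \<oplus>\<^bsub>L2 G\<^esub> \<rho> g h"
    if "g \<in> carrier G" "f \<in> carrier (L2 G)" "h \<in> carrier (L2 G)" for g f h
    by (rule LinearCombinations.module_hom_add[OF right_regular_hom[OF that(1)] that(2,3)])
  have rho_smult: "\<rho> g (a \<odot>\<^bsub>L2 G\<^esub> f) = a \<odot>\<^bsub>L2 G\<^esub> \<rho> g f"
    if "g \<in> carrier G" "f \<in> carrier (L2 G)" for g f a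
    by (rule LinearCombinations.module_hom_smult[OF right_regular_hom[OF that(1)] _ that(2)]) simp
  have \<sigma>_hom: "\<sigma> g \<in> LinearCombinations.module_hom class_ring ?V ?V" if g: "g \<in> carrier G" for g
    unfolding LinearCombinations.module_hom_def
  proof (intro CollectI conjI allI impI)
    fix c d assume "c \<in> carrier ?V \<and> d \<in> carrier ?V"
    then have "c \<in> carrier_vec m" "d \<in> carrier_vec m" by (auto simp: module_vec_simps)
    then have "\<sigma> g (c + d) = \<sigma> g c + \<sigma> g d"
      using g by (intro \<Theta>_eqI) (simp_all add: \<sigma>V \<Theta>\<sigma> \<Theta>_add rho_add \<Theta>L)
    then show "\<sigma> g (c \<oplus>\<^bsub>?V\<^esub> d) = \<sigma> g c \<oplus>\<^bsub>?V\<^esub> \<sigma> g d" by (simp add: module_vec_simps)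
  next
    fix a :: complex and c assume "a \<in> carrier class_ring \<and> c \<in> carrier ?V"
    then have "c \<in> carrier_vec m" by (auto simp: module_vec_simps)
    then have "\<sigma> g (a \<cdot>\<^sub>v c) = a \<cdot>\<^sub>v \<sigma> g c"
      using g by (intro \<Theta>_eqI) (simp_all add: \<sigma>V \<Theta>\<sigma> \<Theta>_smult rho_smult \<Theta>L)
    then show "\<sigma> g (a \<odot>\<^bsub>?V\<^esub> c) = a \<odot>\<^bsub>?V\<^esub> \<sigma> g c" by (simp add: module_vec_simps)
  qed (use \<sigma>V in \<open>auto simp: module_vec_simps\<close>)
  have rep: "linear_rep G ?V \<sigma>"
  proof (rule linear_repI[OF vec_vs])
    fix g h c assume gh: "g \<in> carrier G" "h \<in> carrier G" "c \<in> carrier ?V"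
    then show "\<sigma> (g \<otimes> h) c = \<sigma> g (\<sigma> h c)"
      by (intro \<Theta>_eqI) (simp_all add: module_vec_simps \<sigma>V \<Theta>\<sigma> right_regular_mult \<Theta>L)
  next
    fix c assume "c \<in> carrier ?V"
    then show "\<sigma> \<one> c = c"
      by (intro \<Theta>_eqI) (simp_all add: module_vec_simps \<sigma>V \<Theta>\<sigma> right_regular_one \<Theta>L)
  qed (use \<sigma>_hom in \<open>auto simp: \<sigma>_def module_vec_simps\<close>)
  have "irreducible_unitary_rep G ?V (\<lambda>u v. u \<bullet>c v) \<sigma>"
  proof (intro irreducible_unitary_rep.intro irreducible_unitary_rep_axioms.intro rep inner_product_vec)
    show "vectorspace.fin_dim class_ring ?V"
    proof -
      interpret vec_space "TYPE(complex)" m .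
      show ?thesis by simp
    qed
  next
    fix g c d assume "g \<in> carrier G" "c \<in> carrier ?V" "d \<in> carrier ?V"
    then have g: "g \<in> carrier G" and c: "c \<in> carrier_vec m" and d: "d \<in> carrier_vec m"
      by (auto simp: module_vec_simps)
    have "\<sigma> g c \<bullet>c \<sigma> g d = L2_inner G (\<rho> g (\<Theta> c)) (\<rho> g (\<Theta> d))"
      using c d g by (simp add: \<sigma>_def isom inv \<Theta>N)
    also have "\<dots> = L2_inner G (\<Theta> c) (\<Theta> d)"
      using g \<Theta>L by (intro right_regular_unitary)
    also have "\<dots> = \<Psi> (\<Theta> c) \<bullet>c \<Psi> (\<Theta> d)"
      by (simp add: isom \<Theta>N)
    finally show "\<sigma> g c \<bullet>c \<sigma> g d = c \<bullet>c d"
      using c d by (simp add: \<Psi>\<Theta>)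
  next
    show "carrier ?V \<noteq> {\<zero>\<^bsub>?V\<^esub>}"
    proof
      assume "carrier ?V = {\<zero>\<^bsub>?V\<^esub>}"
      then have "carrier_vec m = {0\<^sub>v m :: complex vec}" by (simp add: module_vec_simps)
      then have "N = {\<zero>\<^bsub>L2 G\<^esub>}" using img \<Theta>0 by (metis image_empty image_insert)
      then show False using N by simp
    qed
  next
    fix W assume W: "VectorSpace.subspace class_ring W ?V"
      and Winv: "\<And>g c. g \<in> carrier G \<Longrightarrow> c \<in> W \<Longrightarrow> \<sigma> g c \<in> W"
    have WV: "W \<subseteq> carrier_vec m" and W0: "0\<^sub>v m \<in> W"
      and Wadd: "\<And>c d. c \<in> W \<Longrightarrow> d \<in> W \<Longrightarrow> c + d \<in> W" and Wsm: "\<And>a c. c \<in> W \<Longrightarrow> a \<cdot>\<^sub>v c \<in> W"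
      using W by (auto simp: VectorSpace.subspace_def submodule_def module_vec_simps)
    \<comment> \<open>Irreducibility is minimality of \<open>N\<close> pulled back:
      \<open>\<Theta>\<close> maps an invariant \<open>W\<close> to an invariant subspace of
      \<open>N\<close>, and injectivity recovers \<open>W\<close> from its image.\<close>
    have "VectorSpace.subspace class_ring (\<Theta> ` W) (L2 G)"
    proof (rule L2.subspaceI)
      show "\<zero>\<^bsub>L2 G\<^esub> \<in> \<Theta> ` W" using W0 \<Theta>0 by (metis imageI)
      show "f \<oplus>\<^bsub>L2 G\<^esub> h \<in> \<Theta> ` W" if "f \<in> \<Theta> ` W" "h \<in> \<Theta> ` W" for f h
        using that WV Wadd by (auto simp: \<Theta>_add[symmetric] subset_iff)
      show "a \<odot>\<^bsub>L2 G\<^esub> f \<in> \<Theta> ` W" if "f \<in> \<Theta> ` W" for a f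
        using that WV Wsm by (auto simp: \<Theta>_smult[symmetric] subset_iff)
    qed (use \<Theta>L in auto)
    moreover have "\<rho> g f \<in> \<Theta> ` W" if "g \<in> carrier G" "f \<in> \<Theta> ` W" for g f
      using that WV Winv by (auto simp: \<Theta>\<sigma>[symmetric] subset_iff)
    ultimately have "\<Theta> ` W = {\<zero>\<^bsub>L2 G\<^esub>} \<or> \<Theta> ` W = N"
      using \<Theta>N by (intro minimal) (auto simp: invariant_def)
    moreover have "W = {0\<^sub>v m}" if "\<Theta> ` W = \<Theta> ` {0\<^sub>v m}"
      using that inj_on_image_eq_iff[OF inj WV, of "{0\<^sub>v m}"] by simp
    moreover have "W = carrier_vec m" if "\<Theta> ` W = \<Theta> ` carrier_vec m"
      using that inj_on_image_eq_iff[OF inj WV, of "carrier_vec m"] by simp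
    ultimately have "W = {0\<^sub>v m} \<or> W = carrier_vec m"
      using img \<Theta>0 by auto
    then show "W = {\<zero>\<^bsub>?V\<^esub>} \<or> W = carrier ?V" by (simp add: module_vec_simps)
  qed
  then show ?thesis
    using that \<Theta>_hom img \<Theta>\<sigma> by (simp add: module_vec_simps)
qed

end


section \<open>Completeness of the matrix coefficients\<close>

lemma hom_inv_into:
  assumes V: "complex_vectorspace V" and \<phi>: "\<phi> \<in> LinearCombinations.module_hom class_ring V W"
    and bij: "bij_betw \<phi> (carrier V) (carrier W)"
  shows "inv_into (carrier V) \<phi> \<in> LinearCombinations.module_hom class_ring W V"
proof -
  interpret V: complex_vectorspace V by fact
  let ?\<psi> = "inv_into (carrier V) \<phi>"
  have inj: "inj_on \<phi> (carrier V)" and img: "\<phi> ` carrier V = carrier W"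
    using bij by (auto simp: bij_betw_def)
  have \<psi>V: "?\<psi> w \<in> carrier V" and \<phi>\<psi>: "\<phi> (?\<psi> w) = w" if "w \<in> carrier W" for w
    using that img by (auto intro: inv_into_into f_inv_into_f)
  have "?\<psi> (w \<oplus>\<^bsub>W\<^esub> z) = ?\<psi> w \<oplus>\<^bsub>V\<^esub> ?\<psi> z" if "w \<in> carrier W" "z \<in> carrier W" for w z
  proof -
    have "\<phi> (?\<psi> w \<oplus>\<^bsub>V\<^esub> ?\<psi> z) = w \<oplus>\<^bsub>W\<^esub> z"
      using that by (simp add: LinearCombinations.module_hom_add[OF \<phi>] \<psi>V \<phi>\<psi>)
    then show ?thesis using inv_into_f_f[OF inj] that \<psi>V by (metis V.M.a_closed)
  qed
  moreover have "?\<psi> (a \<odot>\<^bsub>W\<^esub> w) = a \<odot>\<^bsub>V\<^esub> ?\<psi> w" if "w \<in> carrier W" for a w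
  proof -
    have "\<phi> (a \<odot>\<^bsub>V\<^esub> ?\<psi> w) = a \<odot>\<^bsub>W\<^esub> w"
      using that by (simp add: LinearCombinations.module_hom_smult[OF \<phi>] \<psi>V \<phi>\<psi>)
    then show ?thesis using inv_into_f_f[OF inj] that \<psi>V by (metis V.smult_closed')
  qed
  ultimately show ?thesis
    using \<psi>V by (auto simp: LinearCombinations.module_hom_def)
qed

locale irreps_with_bases = finite_group G + all_irreps G r U ip \<pi>
  for G :: "('g, 'z) monoid_scheme" (structure) and r and U :: "nat \<Rightarrow> (complex, 'v) module"
    and ip \<pi> +
  fixes b :: "nat \<Rightarrow> nat \<Rightarrow> 'v"
  assumes bases: "k \<in> {1..r} \<Longrightarrow> orthonormal_basis (U k) (ip k) (b k)"
begin

abbreviation d :: "nat \<Rightarrow> nat" where "d k \<equiv> vectorspace.dim class_ring (U k)"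

abbreviation e :: "nat \<Rightarrow> nat \<Rightarrow> nat \<Rightarrow> 'g \<Rightarrow> complex" where
  "e k \<equiv> matrix_coeff G (U k) (\<pi> k) (b k)"

abbreviation I :: "(nat \<times> nat \<times> nat) set" where
  "I \<equiv> SIGMA k:{1..r}. {1..d k} \<times> {1..d k}"

text \<open>Fourier coefficients. The factor is the inverse of the squared norm of
  \<open>e k i j\<close>, which makes these functionals dual to the matrix coefficients.\<close>

definition coord :: "nat \<times> nat \<times> nat \<Rightarrow> ('g \<Rightarrow> complex) \<Rightarrow> complex" where
  "coord = (\<lambda>(k, i, j) f. of_nat (d k) / of_nat (card (carrier G)) * L2_inner G f (e k i j))"

lemma rep: "k \<in> {1..r} \<Longrightarrow> onb_rep G (U k) (ip k) (\<pi> k) (b k)"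
  by (intro onb_rep.intro onb_rep_axioms.intro irrep bases is_group)

lemma matrix_coeff_closed: "e k i j \<in> carrier (L2 G)"
  by (simp add: matrix_coeff_def carrier_L2)

lemma matrix_coeff_eq:
  assumes "k \<in> {1..r}" "i \<in> {1..d k}" "j \<in> {1..d k}" "g \<in> carrier G"
  shows "e k i j g = ip k (\<pi> k g (b k j)) (b k i)"
proof -
  interpret k: onb_rep G "U k" "ip k" "\<pi> k" "b k" by (rule rep) fact
  show ?thesis
    using assms k.coordinates_b[OF k.rep_carrier[OF assms(4) k.b_carrier[OF assms(3)]] assms(2)]
    by (simp add: matrix_coeff_def)
qed

lemma matrix_coeff_mult:
  assumes "k \<in> {1..r}" "i \<in> {1..d k}" "j \<in> {1..d k}" "g \<in> carrier G" "h \<in> carrier G"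
  shows "e k i j (g \<otimes> h) = (\<Sum>l\<in>{1..d k}. e k i l g * e k l j h)"
proof -
  interpret k: onb_rep G "U k" "ip k" "\<pi> k" "b k" by (rule rep) fact
  show ?thesis
    using assms by (simp add: matrix_coeff_eq k.coeff_mult del: atLeastAtMost_iff)
qed

lemma matrix_coeff_inner:
  assumes "k \<in> {1..r}" "i \<in> {1..d k}" "j \<in> {1..d k}" "l \<in> {1..r}" "p \<in> {1..d l}" "q \<in> {1..d l}"
  shows "L2_inner G (e k i j) (e l p q) =
    (if k = l \<and> i = p \<and> j = q then of_nat (card (carrier G)) / of_nat (d k) else 0)"
proof -
  interpret k: onb_rep G "U k" "ip k" "\<pi> k" "b k" by (rule rep) fact
  have eq: "L2_inner G (e k i j) (e l p q) =
      (\<Sum>g\<in>carrier G. ip k (\<pi> k g (b k j)) (b k i) * cnj (ip l (\<pi> l g (b l q)) (b l p)))"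
    unfolding L2_inner_def using assms by (intro sum.cong refl) (simp add: matrix_coeff_eq)
  show ?thesis
  proof (cases "k = l")
    case True
    then show ?thesis
      using k.coeff_orthonormal[OF finite_carrier, of i j p q] assms unfolding eq by simp
  next
    case False
    then show ?thesis
      using k.coeff_orthogonal[OF rep[OF assms(4)] finite_carrier pairwise_nonisomorphic] assms
      unfolding eq by simp
  qed
qed

lemma right_regular_matrix_coeff:
  assumes "k \<in> {1..r}" "i \<in> {1..d k}" "j \<in> {1..d k}" "g \<in> carrier G"
  shows "\<rho> g (e k i j) = (\<Oplus>\<^bsub>L2 G\<^esub>l\<in>{1..d k}. e k l j g \<odot>\<^bsub>L2 G\<^esub> e k i l)"
proof (rule L2_eqI[where G = G])
  fix x assume x: "x \<in> carrier G"
  have "(\<Oplus>\<^bsub>L2 G\<^esub>l\<in>{1..d k}. e k l j g \<odot>\<^bsub>L2 G\<^esub> e k i l) x = (\<Sum>l\<in>{1..d k}. e k l j g * e k i l x)"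
    using x by (subst finsum_L2) (auto simp: matrix_coeff_closed smult_L2 carrier_L2)
  then show "\<rho> g (e k i j) x = (\<Oplus>\<^bsub>L2 G\<^esub>l\<in>{1..d k}. e k l j g \<odot>\<^bsub>L2 G\<^esub> e k i l) x"
    using assms x
    by (simp add: right_regular_apply matrix_coeff_closed matrix_coeff_mult mult.commute del: atLeastAtMost_iff)
qed (auto intro!: L2.finsum_closed simp: matrix_coeff_closed right_regular_closed)

text \<open>Kept general in \<open>L\<close> so that one identity serves inner products, point
  values, Fourier coefficients and values of operators.\<close>

lemma linear_on_right_regular_matrix_coeff:
  assumes "k \<in> {1..r}" "i \<in> {1..d k}" "j \<in> {1..d k}" "g \<in> carrier G" and L: "linear_on (L2 G) L"
  shows "L (\<rho> g (e k i j)) = (\<Sum>l\<in>{1..d k}. e k l j g * L (e k i l))"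
proof -
  have "L (\<rho> g (e k i j)) = (\<Sum>l\<in>{1..d k}. L (e k l j g \<odot>\<^bsub>L2 G\<^esub> e k i l))"
    unfolding right_regular_matrix_coeff[OF assms(1-4)]
    by (rule L2.linear_on_finsum[OF L]) (auto simp: matrix_coeff_closed)
  then show ?thesis
    using L matrix_coeff_closed by (simp add: linear_on_def)
qed

section \<open>The orthogonal complement of the matrix coefficients\<close>

definition coeff_perp :: "('g \<Rightarrow> complex) set" where
  "coeff_perp = {f \<in> carrier (L2 G). \<forall>(k, i, j)\<in>I. L2_inner G f (e k i j) = 0}"

text \<open>Unitarity moves \<open>\<rho> g\<close> to \<open>\<rho> (inv g)\<close> on the
  coefficient, and the translate of a coefficient is a combination of coefficients in the same
  row.\<close>

lemma coeff_perp_invariant: "invariant coeff_perp"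
  unfolding invariant_def
proof (intro conjI ballI)
  show "VectorSpace.subspace class_ring coeff_perp (L2 G)"
    by (rule L2.subspaceI)
      (auto simp: coeff_perp_def L2.ip_zero_left' L2.add_left L2.smult_left matrix_coeff_closed)
next
  fix g f assume g: "g \<in> carrier G" and f: "f \<in> coeff_perp"
  have "L2_inner G (\<rho> g f) (e k i j) = 0" if "k \<in> {1..r}" "i \<in> {1..d k}" "j \<in> {1..d k}" for k i j
  proof -
    have fL: "f \<in> carrier (L2 G)" using f by (simp add: coeff_perp_def)
    have "L2_inner G (\<rho> g f) (e k i j) = L2_inner G (\<rho> g f) (\<rho> g (\<rho> (inv g) (e k i j)))"
      using g matrix_coeff_closed by (simp add: right_regular_mult[symmetric] right_regular_one)
    also have "\<dots> = L2_inner G f (\<rho> (inv g) (e k i j))"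
      using g fL by (intro right_regular_unitary right_regular_closed matrix_coeff_closed)
    also have "\<dots> = cnj (L2_inner G (\<rho> (inv g) (e k i j)) f)"
      using fL by (intro L2.conj_sym right_regular_closed matrix_coeff_closed)
    also have "L2_inner G (\<rho> (inv g) (e k i j)) f =
        (\<Sum>l\<in>{1..d k}. e k l j (inv g) * L2_inner G (e k i l) f)"
      using g that fL by (intro linear_on_right_regular_matrix_coeff L2.linear_on_ip_left) auto
    also have "\<dots> = (\<Sum>l\<in>{1..d k}. e k l j (inv g) * cnj (L2_inner G f (e k i l)))"
      using fL by (intro sum.cong refl arg_cong2[of _ _ _ _ "(*)"] L2.conj_sym matrix_coeff_closed)
    also have "\<dots> = 0"
      using f that by (intro sum.neutral) (auto simp: coeff_perp_def)
    finally show ?thesis by simp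
  qed
  moreover have "f \<in> carrier (L2 G)" using f by (simp add: coeff_perp_def)
  ultimately show "\<rho> g f \<in> coeff_perp"
    by (auto simp: coeff_perp_def right_regular_closed)
qed

lemma coeff_perp_trivial: "coeff_perp = {\<zero>\<^bsub>L2 G\<^esub>}"
proof (rule ccontr)
  assume nz: "coeff_perp \<noteq> {\<zero>\<^bsub>L2 G\<^esub>}"
  obtain N where N: "invariant N" "N \<subseteq> coeff_perp" "N \<noteq> {\<zero>\<^bsub>L2 G\<^esub>}"
    and minimal: "\<And>K. invariant K \<Longrightarrow> K \<subseteq> N \<Longrightarrow> K = {\<zero>\<^bsub>L2 G\<^esub>} \<or> K = N"
    using minimal_invariant_exists[OF coeff_perp_invariant nz] by metis
  obtain m \<Theta> \<sigma> where \<sigma>: "irreducible_unitary_rep G (module_vec TYPE(complex) m) (\<lambda>u v. u \<bullet>c v) \<sigma>"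
    and \<Theta>: "\<Theta> \<in> LinearCombinations.module_hom class_ring (module_vec TYPE(complex) m) (L2 G)"
    and img: "\<Theta> ` carrier (module_vec TYPE(complex) m) = N"
    and \<Theta>\<sigma>: "\<And>g v. g \<in> carrier G \<Longrightarrow> v \<in> carrier (module_vec TYPE(complex) m) \<Longrightarrow> \<Theta> (\<sigma> g v) = \<rho> g (\<Theta> v)"
    using minimal_invariant_irreducible_rep[OF N(1,3) minimal] by metis
  let ?V = "module_vec TYPE(complex) m"
  obtain k \<phi> where k: "k \<in> {1..r}"
    and \<phi>: "\<phi> \<in> LinearCombinations.module_hom class_ring ?V (U k)"
    and bij: "bij_betw \<phi> (carrier ?V) (carrier (U k))"
    and \<phi>\<sigma>: "\<And>g v. g \<in> carrier G \<Longrightarrow> v \<in> carrier ?V \<Longrightarrow> \<phi> (\<sigma> g v) = \<pi> k g (\<phi> v)"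
    using exhaustive[OF \<sigma>] unfolding isomorphic_reps_def by blast
  interpret k: onb_rep G "U k" "ip k" "\<pi> k" "b k" by (rule rep[OF k])
  interpret \<sigma>: irreducible_unitary_rep G ?V "\<lambda>u v. u \<bullet>c v" \<sigma> by fact
  have \<Theta>L: "\<Theta> v \<in> carrier (L2 G)" if "v \<in> carrier ?V" for v
    using LinearCombinations.module_hom_closed[OF \<Theta>] that by auto
  have \<phi>U: "\<phi> v \<in> carrier (U k)" if "v \<in> carrier ?V" for v
    using LinearCombinations.module_hom_closed[OF \<phi>] that by auto
  have \<sigma>V: "\<sigma> g v \<in> carrier ?V" if "g \<in> carrier G" "v \<in> carrier ?V" for g v
    using group_action.element_image[OF \<sigma>.action that] by simp
  \<comment> \<open>Evaluation at the identity, carried to \<open>U k\<close> along the inverse of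
    \<open>\<phi>\<close>. As \<open>f g\<close> is the value of \<open>\<rho> g f\<close> at the
    identity, it becomes \<open>\<Lambda> (\<pi> k g (\<phi> v))\<close>.\<close>
  define \<Lambda> where "\<Lambda> u = \<Theta> (inv_into (carrier ?V) \<phi> u) \<one>" for u
  have \<Lambda>: "linear_on (U k) \<Lambda>"
    unfolding \<Lambda>_def
    by (rule linear_on_hom[OF hom_inv_into[OF _ \<phi> bij]])
      (use linear_on_hom[OF \<Theta> linear_on_eval[OF one_closed]] vec_vs in \<open>simp_all add: complex_vectorspace_def\<close>)
  have \<Lambda>\<phi>: "\<Lambda> (\<phi> v) = \<Theta> v \<one>" if "v \<in> carrier ?V" for v
    using that bij by (simp add: \<Lambda>_def bij_betw_def inv_into_f_f)
  have "f = \<zero>\<^bsub>L2 G\<^esub>" if "f \<in> N" for f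
  proof (rule ccontr)
    assume "f \<noteq> \<zero>\<^bsub>L2 G\<^esub>"
    obtain v where v: "v \<in> carrier ?V" "f = \<Theta> v"
      using \<open>f \<in> N\<close> img by auto
    have fL: "f \<in> carrier (L2 G)" using v \<Theta>L by simp
    \<comment> \<open>Expanding first \<open>\<phi> v\<close> and then
      \<open>\<pi> k g (b k q)\<close> in the orthonormal basis leaves these products as the
      coefficients of \<open>e k p q\<close>.\<close>
    define a where "a p q = ip k (\<phi> v) (b k q) * \<Lambda> (b k p)" for p q
    have f: "f g = (\<Sum>q\<in>{1..d k}. \<Sum>p\<in>{1..d k}. a p q * e k p q g)" if g: "g \<in> carrier G" for g
    proof -
      have "f g = \<rho> g f \<one>"
        using g fL by (simp add: right_regular_apply)
      also have "\<dots> = \<Lambda> (\<pi> k g (\<phi> v))"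
        using g v by (simp add: \<Theta>\<sigma>[symmetric] \<phi>\<sigma>[symmetric] \<Lambda>\<phi> \<sigma>V)
      also have "\<dots> = (\<Sum>q\<in>{1..d k}. ip k (\<phi> v) (b k q) * \<Lambda> (\<pi> k g (b k q)))"
        using g v by (intro k.linear_on_expansion linear_on_hom[OF k.rep_hom \<Lambda>] \<phi>U)
      also have "\<dots> = (\<Sum>q\<in>{1..d k}. \<Sum>p\<in>{1..d k}. a p q * e k p q g)"
      proof (intro sum.cong refl)
        fix q assume q: "q \<in> {1..d k}"
        have "\<Lambda> (\<pi> k g (b k q)) = (\<Sum>p\<in>{1..d k}. ip k (\<pi> k g (b k q)) (b k p) * \<Lambda> (b k p))"
          using g q by (intro k.linear_on_expansion \<Lambda> k.rep_carrier k.b_carrier)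
        also have "\<dots> = (\<Sum>p\<in>{1..d k}. e k p q g * \<Lambda> (b k p))"
          using g q k by (intro sum.cong refl) (simp add: matrix_coeff_eq del: atLeastAtMost_iff)
        finally show "ip k (\<phi> v) (b k q) * \<Lambda> (\<pi> k g (b k q)) = (\<Sum>p\<in>{1..d k}. a p q * e k p q g)"
          by (simp add: a_def sum_distrib_left mult_ac del: atLeastAtMost_iff)
      qed
      finally show ?thesis .
    qed
    \<comment> \<open>Expanding only the conjugated factor turns the squared norm of
      \<open>f\<close> into a combination of its inner products with the coefficients, all zero
      because \<open>f\<close> lies in \<open>coeff_perp\<close>.\<close>
    have "L2_inner G f f =
        (\<Sum>g\<in>carrier G. \<Sum>q\<in>{1..d k}. \<Sum>p\<in>{1..d k}. cnj (a p q) * (f g * cnj (e k p q g)))"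
      unfolding L2_inner_def
    proof (intro sum.cong refl)
      fix g assume "g \<in> carrier G"
      from f[OF this] have "cnj (f g) = (\<Sum>q\<in>{1..d k}. \<Sum>p\<in>{1..d k}. cnj (a p q) * cnj (e k p q g))"
        by simp
      then show "f g * cnj (f g) = (\<Sum>q\<in>{1..d k}. \<Sum>p\<in>{1..d k}. cnj (a p q) * (f g * cnj (e k p q g)))"
        by (simp add: sum_distrib_left mult_ac)
    qed
    also have "\<dots> = (\<Sum>q\<in>{1..d k}. \<Sum>p\<in>{1..d k}. \<Sum>g\<in>carrier G. cnj (a p q) * (f g * cnj (e k p q g)))"
      by (subst sum.swap, rule sum.cong[OF refl], rule sum.swap)
    also have "\<dots> = (\<Sum>q\<in>{1..d k}. \<Sum>p\<in>{1..d k}. cnj (a p q) * L2_inner G f (e k p q))"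
      by (simp add: L2_inner_def sum_distrib_left)
    also have "\<dots> = 0"
      using N(2) \<open>f \<in> N\<close> k by (intro sum.neutral ballI) (auto simp: coeff_perp_def)
    finally show False
      using L2.pos_def[OF fL \<open>f \<noteq> \<zero>\<^bsub>L2 G\<^esub>\<close>] by simp
  qed
  moreover have "\<zero>\<^bsub>L2 G\<^esub> \<in> N"
    using N(1) L2.subspace_zero by (simp add: invariant_def)
  ultimately have "N = {\<zero>\<^bsub>L2 G\<^esub>}" by blast
  then show False using N(3) by contradiction
qed

section \<open>Fourier expansion in the matrix coefficients\<close>

lemma finite_I: "finite I" by simp

lemma linear_on_coord: "linear_on (L2 G) (coord t)"
  unfolding coord_def split_def by (intro linear_on_mult_left L2.linear_on_ip_left matrix_coeff_closed)

lemma coord_dual: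
  assumes "(k, i, j) \<in> I" "(l, p, q) \<in> I"
  shows "coord (k, i, j) (e l p q) = (if (k, i, j) = (l, p, q) then 1 else 0)"
proof -
  interpret k: onb_rep G "U k" "ip k" "\<pi> k" "b k" by (rule rep) (use assms in auto)
  have "card (carrier G) \<noteq> 0" "d k \<noteq> 0"
    using finite_carrier one_closed k.dim_pos by auto
  then show ?thesis
    using assms matrix_coeff_inner[of l p q k i j] by (auto simp: coord_def)
qed

abbreviation e' :: "nat \<times> nat \<times> nat \<Rightarrow> 'g \<Rightarrow> complex" where "e' \<equiv> \<lambda>(k, i, j). e k i j"

lemma e'_closed: "e' t \<in> carrier (L2 G)"
  by (cases t) (simp add: matrix_coeff_closed)

lemma coord_e': "t \<in> I \<Longrightarrow> s \<in> I \<Longrightarrow> coord t (e' s) = (if t = s then 1 else 0)"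
  by (cases t, cases s) (simp only: split coord_dual)

text \<open>By duality \<open>f\<close> and its Fourier sum have the same inner products with all
  coefficients, so their difference lies in the trivial space \<open>coeff_perp\<close>.\<close>

lemma coeff_expansion:
  assumes f: "f \<in> carrier (L2 G)"
  shows "f = (\<Oplus>\<^bsub>L2 G\<^esub>t\<in>I. coord t f \<odot>\<^bsub>L2 G\<^esub> e' t)"
proof -
  let ?s = "\<Oplus>\<^bsub>L2 G\<^esub>t\<in>I. coord t f \<odot>\<^bsub>L2 G\<^esub> e' t"
  have s: "?s \<in> carrier (L2 G)"
    using e'_closed by (intro L2.finsum_closed) auto
  have "L2_inner G (f \<ominus>\<^bsub>L2 G\<^esub> ?s) (e k i j) = 0" if kij: "(k, i, j) \<in> I" for k i j
  proof -
    interpret k: onb_rep G "U k" "ip k" "\<pi> k" "b k" by (rule rep) (use kij in auto)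
    have nz: "card (carrier G) \<noteq> 0" "d k \<noteq> 0"
      using finite_carrier one_closed k.dim_pos by auto
    have "coord (k, i, j) ?s = (\<Sum>t\<in>I. coord (k, i, j) (coord t f \<odot>\<^bsub>L2 G\<^esub> e' t))"
      using e'_closed by (intro L2.linear_on_finsum linear_on_coord) auto
    also have "\<dots> = (\<Sum>t\<in>I. coord t f * coord (k, i, j) (e' t))"
      using linear_on_coord e'_closed by (intro sum.cong refl) (simp add: linear_on_def)
    also have "\<dots> = (\<Sum>t\<in>I. coord t f * (if (k, i, j) = t then 1 else 0))"
      using kij by (intro sum.cong refl arg_cong2[of _ _ _ _ "(*)"] coord_e')
    also have "\<dots> = coord (k, i, j) f"
      using kij finite_I by (simp add: if_distrib cong: if_cong del: mem_Sigma_iff)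
    finally have "L2_inner G ?s (e k i j) = L2_inner G f (e k i j)"
      using nz by (simp add: coord_def)
    then show ?thesis
      using f s by (simp add: L2.ip_diff_left matrix_coeff_closed)
  qed
  then have "f \<ominus>\<^bsub>L2 G\<^esub> ?s \<in> coeff_perp"
    using f s by (auto simp: coeff_perp_def)
  then have "f \<ominus>\<^bsub>L2 G\<^esub> ?s = \<zero>\<^bsub>L2 G\<^esub>"
    using coeff_perp_trivial by simp
  then show ?thesis
    using f s by simp
qed

lemma
  shows coeff_inj: "inj_on e' I" and coeff_basis: "L2.basis (e' ` I)"
    and coeff_coordinates: "f \<in> carrier (L2 G) \<Longrightarrow> t \<in> I \<Longrightarrow> coordinates (L2 G) (e' ` I) f (e' t) = coord t f"
proof -
  have e': "e' \<in> I \<rightarrow> carrier (L2 G)" using e'_closed by auto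
  note family = finite_I e' linear_on_coord coord_e' coeff_expansion
  show "inj_on e' I"
    by (rule L2.dual_family_inj[where L = coord, OF family])
  show "L2.basis (e' ` I)"
    by (rule L2.dual_family_is_basis[where L = coord, OF family])
  show "coordinates (L2 G) (e' ` I) f (e' t) = coord t f" if "f \<in> carrier (L2 G)" "t \<in> I"
    by (rule L2.dual_family_coordinates[where L = coord, OF family that])
qed

lemma linear_on_coeff_expansion:
  assumes L: "linear_on (L2 G) L" and f: "f \<in> carrier (L2 G)"
  shows "L f = (\<Sum>t\<in>I. coord t f * L (e' t))"
proof -
  have "L f = L (\<Oplus>\<^bsub>L2 G\<^esub>t\<in>I. coord t f \<odot>\<^bsub>L2 G\<^esub> e' t)"
    using coeff_expansion[OF f] by simp
  also have "\<dots> = (\<Sum>t\<in>I. L (coord t f \<odot>\<^bsub>L2 G\<^esub> e' t))"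
    using e'_closed by (intro L2.linear_on_finsum L) auto
  also have "\<dots> = (\<Sum>t\<in>I. coord t f * L (e' t))"
    using L e'_closed by (intro sum.cong refl) (simp add: linear_on_def)
  finally show ?thesis .
qed

end


section \<open>The transposition operator\<close>

lemma module_hom_compose:
  assumes "A \<in> LinearCombinations.module_hom class_ring V V" "B \<in> LinearCombinations.module_hom class_ring V V"
    and "complex_vectorspace V"
  shows "compose (carrier V) A B \<in> LinearCombinations.module_hom class_ring V V"
proof -
  interpret complex_vectorspace V by fact
  show ?thesis
    using assms(1,2) by (auto simp: LinearCombinations.module_hom_def compose_def Pi_iff)
qed

lemma lin_endos_compose:
  assumes "A \<in> lin_endos V" "B \<in> lin_endos V" "complex_vectorspace V"
  shows "compose (carrier V) A B \<in> lin_endos V"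
  using assms module_hom_compose[of A V B] by (auto simp: lin_endos_def)

lemma lin_endos_closed: "A \<in> lin_endos V \<Longrightarrow> v \<in> carrier V \<Longrightarrow> A v \<in> carrier V"
  by (auto simp: lin_endos_def LinearCombinations.module_hom_def)

context irreps_with_bases
begin

lemma right_regular_lin_endos: "g \<in> carrier G \<Longrightarrow> \<rho> g \<in> lin_endos (L2 G)"
  using right_regular_hom by (auto simp: lin_endos_def right_regular_def)

lemma linear_on_lin_endos_apply:
  assumes "A \<in> lin_endos (L2 G)" "x \<in> carrier G"
  shows "linear_on (L2 G) (\<lambda>f. A f x)"
  using assms linear_on_hom[OF _ linear_on_eval] by (auto simp: lin_endos_def)

text \<open>At a fixed point \<open>x\<close> both operators become functionals, which the Fourier
  expansion determines from their values on coefficients. Outside the carrier extensionality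
  decides.\<close>

lemma lin_endos_eqI:
  assumes A: "A \<in> lin_endos (L2 G)" and B: "B \<in> lin_endos (L2 G)"
    and eq: "\<And>k i j. k \<in> {1..r} \<Longrightarrow> i \<in> {1..d k} \<Longrightarrow> j \<in> {1..d k} \<Longrightarrow> A (e k i j) = B (e k i j)"
  shows "A = B"
proof (rule extensionalityI[of _ "carrier (L2 G)"])
  fix f assume f: "f \<in> carrier (L2 G)"
  show "A f = B f"
  proof (rule L2_eqI[where G = G])
    fix x assume x: "x \<in> carrier G"
    have "A f x = (\<Sum>t\<in>I. coord t f * A (e' t) x)"
      by (rule linear_on_coeff_expansion[OF linear_on_lin_endos_apply[OF A x] f])
    also have "\<dots> = (\<Sum>t\<in>I. coord t f * B (e' t) x)"
      using eq by (intro sum.cong refl) auto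
    also have "\<dots> = B f x"
      by (rule linear_on_coeff_expansion[OF linear_on_lin_endos_apply[OF B x] f, symmetric])
    finally show "A f x = B f x" .
  qed (use lin_endos_closed[OF A f] lin_endos_closed[OF B f] in auto)
qed (use A B in \<open>auto simp: lin_endos_def\<close>)

lemma lin_endos_right_regular_coeff:
  assumes "A \<in> lin_endos (L2 G)" "x \<in> carrier G"
    and "k \<in> {1..r}" "i \<in> {1..d k}" "j \<in> {1..d k}" "g \<in> carrier G"
  shows "A (\<rho> g (e k i j)) x = (\<Sum>l\<in>{1..d k}. e k l j g * A (e k i l) x)"
  by (rule linear_on_right_regular_matrix_coeff[OF assms(3-6) linear_on_lin_endos_apply[OF assms(1,2)]])

section \<open>Existence and uniqueness of the transposition\<close>

lemma transpose_exists: "\<exists>T. transposes_coeffs G r U \<pi> b T"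
proof -
  \<comment> \<open>The Fourier expansion of \<open>f\<close> with the two matrix indices exchanged
    in the functions but not in the coefficients; linearity is inherited from
    \<open>coord\<close>.\<close>
  define T where "T = (\<lambda>f\<in>carrier (L2 G). \<Oplus>\<^bsub>L2 G\<^esub>t\<in>I. coord t f \<odot>\<^bsub>L2 G\<^esub> (case t of (k, i, j) \<Rightarrow> e k j i))"
  have closed: "(case t of (k, i, j) \<Rightarrow> e k j i) \<in> carrier (L2 G)" for t
    by (cases t) (simp add: matrix_coeff_closed)
  have TL: "T f \<in> carrier (L2 G)" if "f \<in> carrier (L2 G)" for f
    using that closed unfolding T_def by (auto intro!: L2.finsum_closed)
  have T_apply: "T f x = (\<Sum>t\<in>I. coord t f * (case t of (k, i, j) \<Rightarrow> e k j i) x)"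
    if "f \<in> carrier (L2 G)" "x \<in> carrier G" for f x
  proof -
    have "T f x = (\<Sum>t\<in>I. (coord t f \<odot>\<^bsub>L2 G\<^esub> (case t of (k, i, j) \<Rightarrow> e k j i)) x)"
      using that closed by (simp add: T_def finsum_L2 del: mem_Sigma_iff)
    then show ?thesis using that by (simp add: smult_L2)
  qed
  have "T (f \<oplus>\<^bsub>L2 G\<^esub> h) = T f \<oplus>\<^bsub>L2 G\<^esub> T h" if "f \<in> carrier (L2 G)" "h \<in> carrier (L2 G)" for f h
  proof (rule L2_eqI[where G = G])
    fix x assume "x \<in> carrier G"
    then show "T (f \<oplus>\<^bsub>L2 G\<^esub> h) x = (T f \<oplus>\<^bsub>L2 G\<^esub> T h) x"
      using that linear_on_coord
      by (simp add: T_apply add_L2[where f = "T f"] linear_on_def ring_distribs sum.distrib)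
  qed (use that TL in auto)
  moreover have "T (a \<odot>\<^bsub>L2 G\<^esub> f) = a \<odot>\<^bsub>L2 G\<^esub> T f" if "f \<in> carrier (L2 G)" for a f
  proof (rule L2_eqI[where G = G])
    fix x assume "x \<in> carrier G"
    then show "T (a \<odot>\<^bsub>L2 G\<^esub> f) x = (a \<odot>\<^bsub>L2 G\<^esub> T f) x"
      using that linear_on_coord
      by (simp add: T_apply smult_L2[where f = "T f"] linear_on_def sum_distrib_left mult.assoc)
  qed (use that TL in auto)
  ultimately have "T \<in> lin_endos (L2 G)"
    using TL by (auto simp: lin_endos_def LinearCombinations.module_hom_def T_def)
  moreover have "T (e k i j) = e k j i" if kij: "(k, i, j) \<in> I" for k i j
  proof (rule L2_eqI[where G = G])
    fix x assume x: "x \<in> carrier G"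
    have "T (e k i j) x = (\<Sum>t\<in>I. coord t (e' (k, i, j)) * (case t of (k, i, j) \<Rightarrow> e k j i) x)"
      using x by (simp add: T_apply matrix_coeff_closed)
    also have "\<dots> = (\<Sum>t\<in>I. (if t = (k, i, j) then 1 else 0) * (case t of (k, i, j) \<Rightarrow> e k j i) x)"
      using kij by (intro sum.cong refl arg_cong2[of _ _ _ _ "(*)"] coord_e')
    also have "\<dots> = (\<Sum>t\<in>I. if t = (k, i, j) then e k j i x else 0)"
      by (intro sum.cong refl) auto
    also have "\<dots> = e k j i x"
      using kij finite_I by (simp del: mem_Sigma_iff)
    finally show "T (e k i j) x = e k j i x" .
  qed (use matrix_coeff_closed TL in auto)
  ultimately show ?thesis
    unfolding transposes_coeffs_def by auto
qed

lemma transpose_unique: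
  assumes "transposes_coeffs G r U \<pi> b S" "transposes_coeffs G r U \<pi> b T"
  shows "S = T"
  using assms by (intro lin_endos_eqI) (auto simp: transposes_coeffs_def)

section \<open>Properties of the transposition and of the conjugate representation\<close>

context
  fixes T
  assumes T: "transposes_coeffs G r U \<pi> b T"
begin

lemma T_lin: "T \<in> lin_endos (L2 G)"
  and T_coeff: "k \<in> {1..r} \<Longrightarrow> i \<in> {1..d k} \<Longrightarrow> j \<in> {1..d k} \<Longrightarrow> T (e k i j) = e k j i"
  using T by (auto simp: transposes_coeffs_def)

lemma T_closed: "f \<in> carrier (L2 G) \<Longrightarrow> T f \<in> carrier (L2 G)"
  by (rule lin_endos_closed[OF T_lin])

lemma T_involution: "L2_comp G T T = (\<lambda>f\<in>carrier (L2 G). f)"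
proof (rule lin_endos_eqI)
  show "L2_comp G T T \<in> lin_endos (L2 G)"
    by (intro lin_endos_compose T_lin complex_vectorspace_L2)
  show "(\<lambda>f\<in>carrier (L2 G). f) \<in> lin_endos (L2 G)"
    by (auto simp: lin_endos_def LinearCombinations.module_hom_def)
qed (simp add: compose_def matrix_coeff_closed T_coeff del: atLeastAtMost_iff)

lemma T_T: "f \<in> carrier (L2 G) \<Longrightarrow> T (T f) = f"
  using fun_cong[OF T_involution, of f] by (simp add: compose_def)

lemma T_automorphism: "T \<in> lin_autos (L2 G)"
proof -
  have "bij_betw T (carrier (L2 G)) (carrier (L2 G))"
    by (rule bij_betw_byWitness[where f' = T]) (auto simp: T_T T_closed)
  then show ?thesis
    using T_lin by (auto simp: lin_autos_def lin_endos_def Bij_def)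
qed

lemma conj_regular_lin_endos: "g \<in> carrier G \<Longrightarrow> conj_regular G T g \<in> lin_endos (L2 G)"
  unfolding conj_regular_def
  by (intro lin_endos_compose T_lin right_regular_lin_endos complex_vectorspace_L2)

lemma conj_regular_apply: "f \<in> carrier (L2 G) \<Longrightarrow> conj_regular G T g f = T (\<rho> g (T f))"
  by (simp add: conj_regular_def compose_def)

text \<open>Multiplicativity holds because the two inner copies of \<open>T\<close> cancel,
  \<open>T\<close> being an involution.\<close>

lemma conj_regular_rep: "linear_rep G (L2 G) (conj_regular G T)"
proof (rule linear_repI[OF vectorspace_L2])
  fix g h f assume "g \<in> carrier G" "h \<in> carrier G" "f \<in> carrier (L2 G)"
  then show "conj_regular G T (g \<otimes> h) f = conj_regular G T g (conj_regular G T h f)"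
    by (simp add: conj_regular_apply T_closed right_regular_closed T_T right_regular_mult)
next
  fix f assume "f \<in> carrier (L2 G)"
  then show "conj_regular G T \<one> f = f"
    by (simp add: conj_regular_apply T_closed T_T right_regular_one)
qed (use conj_regular_lin_endos in \<open>auto simp: lin_endos_def\<close>)

text \<open>Pure involution algebra: the \<open>T\<close> in front of
  \<open>conj_regular G T g\<close> cancels its leading \<open>T\<close>.\<close>

lemma intertwining:
  assumes "g \<in> carrier G"
  shows "L2_comp G (\<rho> g) T = L2_comp G T (conj_regular G T g)"
  unfolding compose_def
  by (intro restrict_ext) (simp add: conj_regular_apply T_closed right_regular_closed T_T)

text \<open>Both sides send \<open>e k i j\<close> to the sum over \<open>l\<close> and
  \<open>m\<close> of \<open>e k l i h * e k m j g\<close> times \<open>e k l m\<close>, reached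
  with the two summations in opposite order.\<close>

lemma regular_commutes:
  assumes g: "g \<in> carrier G" and h: "h \<in> carrier G"
  shows "L2_comp G (\<rho> g) (conj_regular G T h) = L2_comp G (conj_regular G T h) (\<rho> g)"
proof (rule lin_endos_eqI)
  fix k i j assume k: "k \<in> {1..r}" and i: "i \<in> {1..d k}" and j: "j \<in> {1..d k}"
  show "L2_comp G (\<rho> g) (conj_regular G T h) (e k i j) = L2_comp G (conj_regular G T h) (\<rho> g) (e k i j)"
  proof (rule L2_eqI[where G = G])
    fix x assume x: "x \<in> carrier G"
    have "L2_comp G (\<rho> g) (conj_regular G T h) (e k i j) x = L2_comp G (\<rho> g) T (\<rho> h (e k j i)) x"
      using k i j by (simp add: compose_def conj_regular_apply matrix_coeff_closed T_coeff
          right_regular_closed del: atLeastAtMost_iff)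
    \<comment> \<open>The outer \<open>\<rho> g\<close> after \<open>T\<close> is treated as a
      single operator, so that only the inner translate by \<open>h\<close> is expanded.\<close>
    also have "\<dots> = (\<Sum>l\<in>{1..d k}. e k l i h * L2_comp G (\<rho> g) T (e k j l) x)"
      using x k i j g h
      by (intro lin_endos_right_regular_coeff lin_endos_compose right_regular_lin_endos T_lin complex_vectorspace_L2)
    also have "\<dots> = (\<Sum>l\<in>{1..d k}. e k l i h * \<rho> g (e k l j) x)"
      using k j by (intro sum.cong refl)
        (simp add: compose_def matrix_coeff_closed T_coeff del: atLeastAtMost_iff)
    also have "\<dots> = (\<Sum>l\<in>{1..d k}. e k l i h * (\<Sum>m\<in>{1..d k}. e k m j g * e k l m x))"
      using k j g x by (intro sum.cong refl arg_cong2[of _ _ _ _ "(*)"]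
          linear_on_right_regular_matrix_coeff linear_on_eval)
    also have "\<dots> = (\<Sum>m\<in>{1..d k}. e k m j g * (\<Sum>l\<in>{1..d k}. e k l i h * e k l m x))"
      unfolding sum_distrib_left by (subst sum.swap) (simp add: mult_ac)
    also have "\<dots> = (\<Sum>m\<in>{1..d k}. e k m j g * (\<Sum>l\<in>{1..d k}. e k l i h * T (e k m l) x))"
      using k by (intro sum.cong refl) (simp add: T_coeff)
    also have "\<dots> = (\<Sum>m\<in>{1..d k}. e k m j g * T (\<rho> h (e k m i)) x)"
      using k i h x by (intro sum.cong refl arg_cong2[of _ _ _ _ "(*)"]
          lin_endos_right_regular_coeff[symmetric] T_lin)
    also have "\<dots> = (\<Sum>m\<in>{1..d k}. e k m j g * conj_regular G T h (e k i m) x)"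
      using k i by (intro sum.cong refl)
        (simp add: conj_regular_apply matrix_coeff_closed T_coeff del: atLeastAtMost_iff)
    also have "\<dots> = conj_regular G T h (\<rho> g (e k i j)) x"
      using k i j g h x by (intro lin_endos_right_regular_coeff[symmetric] conj_regular_lin_endos)
    finally show "L2_comp G (\<rho> g) (conj_regular G T h) (e k i j) x =
        L2_comp G (conj_regular G T h) (\<rho> g) (e k i j) x"
      by (simp add: compose_def matrix_coeff_closed)
  qed (use g h in \<open>simp_all add: compose_def matrix_coeff_closed right_regular_closed
      lin_endos_closed[OF conj_regular_lin_endos]\<close>)
qed (use g h in \<open>auto intro!: lin_endos_compose right_regular_lin_endos conj_regular_lin_endos complex_vectorspace_L2\<close>)

section \<open>Traces\<close>

lemma rep_trace:
  assumes k: "k \<in> {1..r}" and g: "g \<in> carrier G"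
  shows "op_trace (U k) (\<pi> k g) = (\<Sum>i\<in>{1..d k}. e k i i g)"
proof -
  interpret k: onb_rep G "U k" "ip k" "\<pi> k" "b k" by (rule rep) fact
  have "op_trace (U k) (\<pi> k g) =
      (\<Sum>i\<in>{1..d k}. coordinates (U k) (b k ` {1..d k}) (\<pi> k g (b k i)) (b k i))"
    unfolding k.V.op_trace_eq[OF finite_imageI[OF finite_atLeastAtMost] k.basis_b k.rep_hom[OF g]]
    by (simp only: sum.reindex[OF k.inj_b] o_def)
  then show ?thesis
    using g by (simp add: matrix_coeff_def)
qed

lemma trace_right_regular_T:
  assumes g: "g \<in> carrier G"
  shows "op_trace (L2 G) (L2_comp G (\<rho> g) T) = gelfand_character r U \<pi> g"
proof -
  have lin: "L2_comp G (\<rho> g) T \<in> lin_endos (L2 G)"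
    using g by (intro lin_endos_compose right_regular_lin_endos T_lin complex_vectorspace_L2)
  have "op_trace (L2 G) (L2_comp G (\<rho> g) T) =
      (\<Sum>t\<in>I. coordinates (L2 G) (e' ` I) (L2_comp G (\<rho> g) T (e' t)) (e' t))"
  proof -
    have "L2_comp G (\<rho> g) T \<in> LinearCombinations.module_hom class_ring (L2 G) (L2 G)"
      using lin by (simp add: lin_endos_def)
    then have "op_trace (L2 G) (L2_comp G (\<rho> g) T) =
        (\<Sum>v\<in>e' ` I. coordinates (L2 G) (e' ` I) (L2_comp G (\<rho> g) T v) v)"
      by (rule L2.op_trace_eq[OF finite_imageI[OF finite_I] coeff_basis])
    also have "\<dots> = (\<Sum>t\<in>I. coordinates (L2 G) (e' ` I) (L2_comp G (\<rho> g) T (e' t)) (e' t))"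
      by (rule sum.reindex[OF coeff_inj, unfolded o_def])
    finally show ?thesis .
  qed
  also have "\<dots> = (\<Sum>t\<in>I. coord t (L2_comp G (\<rho> g) T (e' t)))"
    by (rule sum.cong[OF refl], rule coeff_coordinates[OF lin_endos_closed[OF lin e'_closed]])
  also have "\<dots> = (\<Sum>(k, i, j)\<in>I. coord (k, i, j) (\<rho> g (e k j i)))"
    by (intro sum.cong refl) (auto simp: compose_def matrix_coeff_closed T_coeff)
  also have "\<dots> = (\<Sum>k\<in>{1..r}. \<Sum>(i, j)\<in>{1..d k} \<times> {1..d k}. coord (k, i, j) (\<rho> g (e k j i)))"
    by (rule sum.Sigma[symmetric]) auto
  also have "\<dots> = (\<Sum>k\<in>{1..r}. \<Sum>i\<in>{1..d k}. \<Sum>j\<in>{1..d k}. coord (k, i, j) (\<rho> g (e k j i)))"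
    by (simp add: sum.cartesian_product)
  also have "\<dots> = (\<Sum>k\<in>{1..r}. \<Sum>i\<in>{1..d k}. \<Sum>j\<in>{1..d k}. if j = i then e k i i g else 0)"
  proof (intro sum.cong refl)
    fix k i j assume k: "k \<in> {1..r}" and i: "i \<in> {1..d k}" and j: "j \<in> {1..d k}"
    have "coord (k, i, j) (\<rho> g (e k j i)) = (\<Sum>l\<in>{1..d k}. e k l i g * coord (k, i, j) (e k j l))"
      using k i j g by (intro linear_on_right_regular_matrix_coeff linear_on_coord)
    \<comment> \<open>Duality leaves only the terms in which \<open>(i, j)\<close> equals
      \<open>(j, l)\<close>, that is \<open>i = j\<close> and \<open>l = j\<close>.\<close>
    also have "\<dots> = (\<Sum>l\<in>{1..d k}. if l = j then (if j = i then e k i i g else 0) else 0)"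
      using k i j by (intro sum.cong refl) (auto simp: coord_dual)
    finally show "coord (k, i, j) (\<rho> g (e k j i)) = (if j = i then e k i i g else 0)"
      using j by simp
  qed
  also have "\<dots> = (\<Sum>k\<in>{1..r}. op_trace (U k) (\<pi> k g))"
    using g by (intro sum.cong refl) (simp add: rep_trace)
  finally show ?thesis by (simp add: gelfand_character_def)
qed

end

end

theorem theorem1:
  fixes G :: "('g, 'z) monoid_scheme"
    and r :: nat
    and U :: "nat \<Rightarrow> (complex, 'v) module"
    and ip :: "nat \<Rightarrow> 'v \<Rightarrow> 'v \<Rightarrow> complex"
    and \<pi> :: "nat \<Rightarrow> 'g \<Rightarrow> 'v \<Rightarrow> 'v"
    and b :: "nat \<Rightarrow> nat \<Rightarrow> 'v"
  assumes "group G" and "finite (carrier G)"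
    and "all_irreps G r U ip \<pi>"
    and "\<And>k. k \<in> {1..r} \<Longrightarrow> orthonormal_basis (U k) (ip k) (b k)"
  shows "(\<exists>!T. transposes_coeffs G r U \<pi> b T) \<and>
    (\<forall>T. transposes_coeffs G r U \<pi> b T \<longrightarrow>
      T \<in> lin_autos (L2 G) \<and>
      L2_comp G T T = (\<lambda>f\<in>carrier (L2 G). f) \<and>
      linear_rep G (L2 G) (conj_regular G T) \<and>
      (\<forall>g\<in>carrier G.
         L2_comp G (right_regular G g) T = L2_comp G T (conj_regular G T g)) \<and>
      (\<forall>g\<in>carrier G. \<forall>h\<in>carrier G.
         L2_comp G (right_regular G g) (conj_regular G T h) =
         L2_comp G (conj_regular G T h) (right_regular G g)) \<and>
      (\<forall>g\<in>carrier G.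
         op_trace (L2 G) (L2_comp G (right_regular G g) T) = gelfand_character r U \<pi> g))"
proof -
  interpret irreps_with_bases G r U ip \<pi> b
    by (intro irreps_with_bases.intro irreps_with_bases_axioms.intro finite_group.intro
        finite_group_axioms.intro assms)
  show ?thesis
  proof (intro conjI allI impI ballI)
    show "\<exists>!T. transposes_coeffs G r U \<pi> b T"
      using transpose_exists transpose_unique by blast
  qed (use T_automorphism T_involution conj_regular_rep intertwining regular_commutes
      trace_right_regular_T in blast)+
qed

end
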